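(* Let $H : {\rm Dom}(H) \to L^2(\mathbb{R}^-)$ be the operator $(Hw)(z) = -z w_{zz} - 3 w_z + \frac14 (z^2 w)_z$, $z<0$, with ${\rm Dom}(H) = \{ w \in L^2(\mathbb{R}^-) : Hw \in L^2(\mathbb{R}^-)\}$. Let $w \in C(\mathbb{R}^+,{\rm Dom}(H)) \cap C^1(\mathbb{R}^+,L^2(\mathbb{R}^-))$ be a solution of the evolution problem $w_t = Hw$. Then the solution satisfies $$\| w(t) \|_{L^2(\mathbb{R}^-)}^2 \leq \| w(0) \|_{L^2(\mathbb{R}^-)}^2 e^{-t}.$$
   Context: $\mathbb{R}^- = (-\infty,0)$; $\mathbb{R}^+$ is the half-line of times $t \ge 0$; functions are real-valued. *)

theory Defs
  imports "HOL-Analysis.Analysis"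
begin

section \<open>The real Hilbert space $L^2(\mathbb{R}^-)$\<close>

abbreviation neg_leb :: "real measure"
  where "neg_leb \<equiv> lebesgue_on {..<0}"

definition sq_int :: "(real \<Rightarrow> real) \<Rightarrow> bool"
  where "sq_int f \<longleftrightarrow> f \<in> borel_measurable neg_leb \<and> integrable neg_leb (\<lambda>z. (f z)\<^sup>2)"

definition sq_eq :: "(real \<Rightarrow> real) \<Rightarrow> (real \<Rightarrow> real) \<Rightarrow> bool"
  where "sq_eq f g \<longleftrightarrow> sq_int f \<and> sq_int g \<and> (AE z in neg_leb. f z = g z)"

lemma sq_int_zero: "sq_int (\<lambda>z. 0)"
  by (simp add: sq_int_def)

lemma sq_int_mult:
  assumes "sq_int f" "sq_int g"
  shows "integrable neg_leb (\<lambda>z. f z * g z)"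
proof (rule Bochner_Integration.integrable_bound)
  show "integrable neg_leb (\<lambda>z. (f z)\<^sup>2 + (g z)\<^sup>2)"
    using assms by (simp add: sq_int_def)
  show "(\<lambda>z. f z * g z) \<in> borel_measurable neg_leb"
    using assms by (auto simp: sq_int_def)
  have "\<bar>a * b\<bar> \<le> a\<^sup>2 + b\<^sup>2" for a b :: real
  proof -
    have "0 \<le> (\<bar>a\<bar> - \<bar>b\<bar>)\<^sup>2" by simp
    then have "2 * (\<bar>a\<bar> * \<bar>b\<bar>) \<le> a\<^sup>2 + b\<^sup>2"
      by (simp add: power2_diff)
    moreover have "0 \<le> \<bar>a\<bar> * \<bar>b\<bar>" by simp
    ultimately show ?thesis unfolding abs_mult by linarith
  qed
  then show "AE z in neg_leb. norm (f z * g z) \<le> norm ((f z)\<^sup>2 + (g z)\<^sup>2)"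
    by simp
qed

lemma sq_int_add:
  assumes "sq_int f" "sq_int g"
  shows "sq_int (\<lambda>z. f z + g z)"
proof -
  have "integrable neg_leb (\<lambda>z. (f z)\<^sup>2 + (g z)\<^sup>2 + 2 * (f z * g z))"
    using assms sq_int_mult[OF assms] by (simp add: sq_int_def)
  then show ?thesis
    using assms by (auto simp: sq_int_def power2_sum mult.assoc)
qed

lemma sq_int_scale: "sq_int f \<Longrightarrow> sq_int (\<lambda>z. c * f z)"
  by (auto simp: sq_int_def power_mult_distrib)

lemma sq_int_uminus: "sq_int f \<Longrightarrow> sq_int (\<lambda>z. - f z)"
  using sq_int_scale[of f "-1"] by simp

lemma sq_int_diff: "sq_int f \<Longrightarrow> sq_int g \<Longrightarrow> sq_int (\<lambda>z. f z - g z)"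
  using sq_int_add[of f "\<lambda>z. - g z"] sq_int_uminus[of g] by simp

quotient_type L2neg = "real \<Rightarrow> real" / partial: sq_eq
proof (rule part_equivpI)
  show "\<exists>f. sq_eq f f" using sq_int_zero by (auto simp: sq_eq_def)
  show "symp sq_eq" by (auto simp: sq_eq_def symp_def eq_commute)
  show "transp sq_eq"
    unfolding transp_def sq_eq_def by (auto elim: eventually_elim2)
qed

instantiation L2neg :: real_inner
begin

lift_definition zero_L2neg :: L2neg is "\<lambda>z. 0"
  by (simp add: sq_eq_def sq_int_zero)

lift_definition plus_L2neg :: "L2neg \<Rightarrow> L2neg \<Rightarrow> L2neg" is "\<lambda>f g z. f z + g z"
  by (auto simp: sq_eq_def sq_int_add elim: eventually_elim2)

lift_definition minus_L2neg :: "L2neg \<Rightarrow> L2neg \<Rightarrow> L2neg" is "\<lambda>f g z. f z - g z"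
  by (auto simp: sq_eq_def sq_int_diff elim: eventually_elim2)

lift_definition uminus_L2neg :: "L2neg \<Rightarrow> L2neg" is "\<lambda>f z. - f z"
  by (auto simp: sq_eq_def sq_int_uminus)

lift_definition scaleR_L2neg :: "real \<Rightarrow> L2neg \<Rightarrow> L2neg" is "\<lambda>c f z. c * f z"
  by (auto simp: sq_eq_def sq_int_scale elim: eventually_mono)

lift_definition inner_L2neg :: "L2neg \<Rightarrow> L2neg \<Rightarrow> real"
  is "\<lambda>f g. \<integral>z. f z * g z \<partial>neg_leb"
proof -
  fix f f' g g' assume "sq_eq f f'" "sq_eq g g'"
  then show "(\<integral>z. f z * g z \<partial>neg_leb) = (\<integral>z. f' z * g' z \<partial>neg_leb)"
    by (intro integral_cong_AE) (auto simp: sq_eq_def sq_int_def elim: eventually_elim2)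
qed

definition norm_L2neg :: "L2neg \<Rightarrow> real"
  where "norm_L2neg u = sqrt (inner u u)"

definition dist_L2neg :: "L2neg \<Rightarrow> L2neg \<Rightarrow> real"
  where "dist_L2neg u v = norm (u - v)"

definition sgn_L2neg :: "L2neg \<Rightarrow> L2neg"
  where "sgn_L2neg u = inverse (norm u) *\<^sub>R u"

definition uniformity_L2neg :: "(L2neg \<times> L2neg) filter"
  where "uniformity_L2neg = (INF e\<in>{0<..}. principal {(u, v). dist u v < e})"

definition open_L2neg :: "L2neg set \<Rightarrow> bool"
  where "open_L2neg U \<longleftrightarrow> (\<forall>u\<in>U. \<forall>\<^sub>F (u', v) in uniformity. u' = u \<longrightarrow> v \<in> U)"

instance
proof
  fix u v w :: L2neg and a b :: real
  show "u + v + w = u + (v + w)"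
    by transfer (auto simp: sq_eq_def add.assoc intro!: sq_int_add)
  show "u + v = v + u"
    by transfer (auto simp: sq_eq_def add.commute intro!: sq_int_add)
  show "0 + u = u"
    by transfer (auto simp: sq_eq_def)
  show "- u + u = 0"
    by transfer (auto simp: sq_eq_def sq_int_zero)
  show "u - v = u + - v"
    by transfer (auto simp: sq_eq_def intro!: sq_int_diff)
  show "a *\<^sub>R (u + v) = a *\<^sub>R u + a *\<^sub>R v"
    by transfer (auto simp: sq_eq_def distrib_left intro!: sq_int_add sq_int_scale)
  show "(a + b) *\<^sub>R u = a *\<^sub>R u + b *\<^sub>R u"
    by transfer (auto simp: sq_eq_def distrib_right intro!: sq_int_add sq_int_scale)
  show "a *\<^sub>R b *\<^sub>R u = (a * b) *\<^sub>R u"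
    by transfer (auto simp: sq_eq_def mult.assoc intro!: sq_int_scale)
  show "1 *\<^sub>R u = u"
    by transfer (auto simp: sq_eq_def)
  show "inner u v = inner v u"
    by transfer (simp add: mult.commute)
  show "inner (u + v) w = inner u w + inner v w"
  proof transfer
    fix f g h assume "sq_eq f f" "sq_eq g g" "sq_eq h h"
    then show "(\<integral>z. (f z + g z) * h z \<partial>neg_leb)
        = (\<integral>z. f z * h z \<partial>neg_leb) + (\<integral>z. g z * h z \<partial>neg_leb)"
      by (simp add: sq_eq_def distrib_right sq_int_mult)
  qed
  show "inner (a *\<^sub>R u) v = a * inner u v"
    by transfer (simp add: mult.assoc)
  show "0 \<le> inner u u"
    by transfer simp
  show "inner u u = 0 \<longleftrightarrow> u = 0"
  proof transfer
    fix f assume "sq_eq f f"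
    then have f: "sq_int f" by (simp add: sq_eq_def)
    have "(\<integral>z. f z * f z \<partial>neg_leb) = 0 \<longleftrightarrow> (AE z in neg_leb. f z * f z = 0)"
      by (rule integral_nonneg_eq_0_iff_AE) (simp_all add: sq_int_mult f)
    then show "(\<integral>z. f z * f z \<partial>neg_leb) = 0 \<longleftrightarrow> sq_eq f (\<lambda>z. 0)"
      by (simp add: sq_eq_def f sq_int_zero)
  qed
qed (simp_all add: norm_L2neg_def dist_L2neg_def sgn_L2neg_def uniformity_L2neg_def open_L2neg_def)

end

definition fun_of :: "L2neg \<Rightarrow> real \<Rightarrow> real"
  where "fun_of u = (SOME f. sq_int f \<and> abs_L2neg f = u)"


section \<open>Distributions on $\mathbb{R}^-$\<close>

text \<open>
  Distributions are represented by their action on test functions, with equality always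
  understood on \<open>test_fun\<close> only; continuity is never used, since the only
  distributions that occur are derived from functions in $L^2(\mathbb{R}^-)$.
\<close>

type_synonym distr = "(real \<Rightarrow> real) \<Rightarrow> real"

definition test_fun :: "(real \<Rightarrow> real) \<Rightarrow> bool"
  where "test_fun \<phi> \<longleftrightarrow>
    (\<forall>k. (deriv ^^ k) \<phi> differentiable_on UNIV) \<and>
    (\<exists>K. compact K \<and> K \<subseteq> {..<0} \<and> (\<forall>z. z \<notin> K \<longrightarrow> \<phi> z = 0))"

definition distr_of :: "L2neg \<Rightarrow> distr"
  where "distr_of u \<phi> = (\<integral>z. fun_of u z * \<phi> z \<partial>neg_leb)"

definition distr_deriv :: "distr \<Rightarrow> distr"
  where "distr_deriv T \<phi> = - T (deriv \<phi>)"

definition mult_distr :: "(real \<Rightarrow> real) \<Rightarrow> distr \<Rightarrow> distr"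
  where "mult_distr a T \<phi> = T (\<lambda>z. a z * \<phi> z)"


section \<open>The operator \<open>H\<close> on its maximal domain\<close>

definition H_distr :: "distr \<Rightarrow> distr"
  where "H_distr T \<phi> =
    - mult_distr (\<lambda>z. z) (distr_deriv (distr_deriv T)) \<phi> - 3 * distr_deriv T \<phi>
    + 1/4 * distr_deriv (mult_distr (\<lambda>z. z\<^sup>2) T) \<phi>"

definition is_H :: "L2neg \<Rightarrow> L2neg \<Rightarrow> bool"
  where "is_H u f \<longleftrightarrow> (\<forall>\<phi>. test_fun \<phi> \<longrightarrow> H_distr (distr_of u) \<phi> = distr_of f \<phi>)"

definition Dom_H :: "L2neg set"
  where "Dom_H = {u. \<exists>f. is_H u f}"

text \<open>An element of $L^2(\mathbb{R}^-)$ is determined by its action on test functions, so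
  on \<open>Dom_H\<close> the choice below is unique; outside \<open>Dom_H\<close> the value is meaningless.\<close>

definition H :: "L2neg \<Rightarrow> L2neg"
  where "H u = (SOME f. is_H u f)"

text \<open>Continuity into \<open>Dom_H\<close> refers to the graph norm, which is the norm of the pair
  \<open>(u, H u)\<close> in the product space.\<close>

definition continuous_into_Dom_H :: "(real \<Rightarrow> L2neg) \<Rightarrow> bool"
  where "continuous_into_Dom_H w \<longleftrightarrow>
    (\<forall>t\<ge>0. w t \<in> Dom_H) \<and> continuous_on {0..} (\<lambda>t. (w t, H (w t)))"

end

theory Submission
  imports Defs
begin

text \<open>
  Everything rests on the dissipativity estimate \<open>\<langle>w, H w\<rangle> \<le> - \<parallel>w\<parallel>\<^sup>2 / 2\<close> on the maximal domain;
  then \<open>exp t * \<parallel>w t\<parallel>\<^sup>2\<close> is nonincreasing.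

  Since \<open>H w = (- z w' - 2 w + z\<^sup>2 w / 4)'\<close>, a twofold du Bois-Reymond argument shows that for
  \<open>f = H w\<close> in \<open>L\<^sup>2\<close> the function \<open>w\<close> is \<open>C\<^sup>1\<close> and solves \<open>- z w' - 2 w + z\<^sup>2 w / 4 = G\<close>, where
  \<open>G z = c - \<integral>\<^sub>z\<^sup>0 f\<close>. Integration by parts gives, on \<open>[a, b]\<close> with \<open>b < 0\<close>,
  \<open>\<integral> f w + w\<^sup>2 / 2 = E b - E a + \<integral> z (w' - w / 2)\<^sup>2\<close> with
  \<open>E = G w + w\<^sup>2 - z\<^sup>2 w\<^sup>2 / 8 + z w\<^sup>2 / 2\<close>. The boundary terms are found from the integrating factor
  \<open>(z\<^sup>2 exp (- z\<^sup>2 / 8) w)' = - z exp (- z\<^sup>2 / 8) G\<close>: at \<open>0\<close> it forces \<open>w \<rightarrow> - c / 2\<close> and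
  \<open>E \<rightarrow> - c\<^sup>2 / 4\<close>; at \<open>- \<infinity>\<close>, where \<open>G = o(z)\<close>, square integrability of \<open>w\<close> forces \<open>z w \<rightarrow> 0\<close> and
  hence \<open>E \<rightarrow> 0\<close>.
\<close>

section \<open>Smooth functions\<close>

definition smooth :: "(real \<Rightarrow> real) \<Rightarrow> bool"
  where "smooth f \<longleftrightarrow> (\<forall>k. (deriv ^^ k) f differentiable_on UNIV)"

text \<open>Bounding the order makes the closure properties provable by induction on
  \<open>n\<close>: the derivative of a sum, a product or an affine substitution is again built from
  functions that are smooth up to one order less.\<close>

definition smooth_upto :: "nat \<Rightarrow> (real \<Rightarrow> real) \<Rightarrow> bool"
  where "smooth_upto n f \<longleftrightarrow> (\<forall>k\<le>n. (deriv ^^ k) f differentiable_on UNIV)"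

lemma smooth_iff_upto: "smooth f \<longleftrightarrow> (\<forall>n. smooth_upto n f)"
  by (auto simp: smooth_def smooth_upto_def)

lemma smooth_upto_0: "smooth_upto 0 f \<longleftrightarrow> f differentiable_on UNIV"
  by (simp add: smooth_upto_def)

lemma smooth_upto_Suc:
  "smooth_upto (Suc n) f \<longleftrightarrow> f differentiable_on UNIV \<and> smooth_upto n (deriv f)"
proof -
  have "(\<forall>k\<le>Suc n. (deriv ^^ k) f differentiable_on UNIV) \<longleftrightarrow>
      f differentiable_on UNIV \<and> (\<forall>k\<le>n. (deriv ^^ Suc k) f differentiable_on UNIV)"
    by (metis (no_types) Suc_le_mono funpow_0 le0 not0_implies_Suc)
  then show ?thesis
    by (simp add: smooth_upto_def funpow_Suc_right del: funpow.simps)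
qed

lemma smooth_upto_less: "smooth_upto (Suc n) f \<Longrightarrow> smooth_upto n f"
  by (auto simp: smooth_upto_def)

lemma differentiable_on_UNIV_deriv:
  fixes f :: "real \<Rightarrow> real"
  assumes "f differentiable_on UNIV"
  shows "(f has_field_derivative deriv f x) (at x)"
  using assms by (simp add: DERIV_deriv_iff_real_differentiable differentiable_on_def)

lemma smooth_upto_SucI:
  assumes "\<And>x. (f has_field_derivative g x) (at x)" "smooth_upto n g"
  shows "smooth_upto (Suc n) f"
proof -
  have "deriv f = g" using assms(1) by (auto intro: DERIV_imp_deriv)
  then show ?thesis
    using assms by (auto simp: smooth_upto_Suc differentiable_on_def real_differentiable_def)
qed

lemma smooth_upto_add:
  "smooth_upto n f \<Longrightarrow> smooth_upto n g \<Longrightarrow> smooth_upto n (\<lambda>x. f x + g x)"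
proof (induction n arbitrary: f g)
  case (Suc n)
  then have "smooth_upto n (\<lambda>x. deriv f x + deriv g x)" by (simp add: smooth_upto_Suc)
  moreover have "((\<lambda>x. f x + g x) has_field_derivative deriv f x + deriv g x) (at x)" for x
    using Suc.prems by (auto simp: smooth_upto_Suc intro!: DERIV_add differentiable_on_UNIV_deriv)
  ultimately show ?case by (rule smooth_upto_SucI[rotated])
qed (simp add: smooth_upto_0 differentiable_on_add)

lemma smooth_upto_mult:
  "smooth_upto n f \<Longrightarrow> smooth_upto n g \<Longrightarrow> smooth_upto n (\<lambda>x. f x * g x)"
proof (induction n arbitrary: f g)
  case (Suc n)
  then have "smooth_upto n (\<lambda>x. deriv f x * g x + deriv g x * f x)"
    using smooth_upto_less[OF Suc.prems(1)] smooth_upto_less[OF Suc.prems(2)]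
    by (auto simp: smooth_upto_Suc intro!: smooth_upto_add)
  moreover have "((\<lambda>x. f x * g x) has_field_derivative deriv f x * g x + deriv g x * f x) (at x)"
    for x
    using Suc.prems by (auto simp: smooth_upto_Suc intro!: DERIV_mult differentiable_on_UNIV_deriv)
  ultimately show ?case by (rule smooth_upto_SucI[rotated])
qed (simp add: smooth_upto_0 differentiable_on_mult)

lemma smooth_upto_const: "smooth_upto n (\<lambda>x. c)"
proof (induction n arbitrary: c)
  case (Suc n)
  show ?case by (rule smooth_upto_SucI[OF DERIV_const Suc])
qed (simp add: smooth_upto_0)

lemma smooth_upto_affine:
  "smooth_upto n f \<Longrightarrow> smooth_upto n (\<lambda>x. f (c * x + d))"
proof (induction n arbitrary: f)
  case 0
  then show ?case
    unfolding smooth_upto_0 differentiable_on_def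
    using differentiable_compose[of f "\<lambda>x. c * x + d"] by auto
next
  case (Suc n)
  have "smooth_upto n (\<lambda>x. deriv f (c * x + d) * c)"
    using Suc by (intro smooth_upto_mult smooth_upto_const) (auto simp: smooth_upto_Suc)
  moreover have "((\<lambda>x. f (c * x + d)) has_field_derivative deriv f (c * x + d) * c) (at x)" for x
    using Suc.prems
    by (intro DERIV_chain2[of f]) (auto simp: smooth_upto_Suc intro!: differentiable_on_UNIV_deriv derivative_eq_intros)
  ultimately show ?case by (rule smooth_upto_SucI[rotated])
qed

lemma smoothI: "(\<And>x. (f has_field_derivative g x) (at x)) \<Longrightarrow> smooth g \<Longrightarrow> smooth f"
  by (metis smooth_iff_upto smooth_upto_SucI smooth_upto_less)

lemma smooth_deriv: "smooth f \<Longrightarrow> smooth (deriv f)"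
  by (meson smooth_iff_upto smooth_upto_Suc)

lemma smooth_has_deriv: "smooth f \<Longrightarrow> (f has_field_derivative deriv f x) (at x)"
  by (meson differentiable_on_UNIV_deriv smooth_iff_upto smooth_upto_Suc)

lemma smooth_continuous_on: "smooth f \<Longrightarrow> continuous_on A f"
  by (meson DERIV_continuous continuous_at_imp_continuous_on smooth_has_deriv)

lemma smooth_const: "smooth (\<lambda>x. c)"
  by (simp add: smooth_iff_upto smooth_upto_const)

lemma smooth_add: "smooth f \<Longrightarrow> smooth g \<Longrightarrow> smooth (\<lambda>x. f x + g x)"
  by (simp add: smooth_iff_upto smooth_upto_add)

lemma smooth_mult: "smooth f \<Longrightarrow> smooth g \<Longrightarrow> smooth (\<lambda>x. f x * g x)"
  by (simp add: smooth_iff_upto smooth_upto_mult)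

lemma smooth_affine: "smooth f \<Longrightarrow> smooth (\<lambda>x. f (c * x + d))"
  by (simp add: smooth_iff_upto smooth_upto_affine)

text \<open>This class of functions is closed under differentiation, which gives smoothness of
  \<open>exp (- 1 / x)\<close> extended by zero.\<close>

definition flat :: "real poly \<Rightarrow> real \<Rightarrow> real"
  where "flat p x = (if x > 0 then poly p (1 / x) * exp (- (1 / x)) else 0)"

text \<open>With \<open>y = 1 / x\<close> this is the decay of \<open>poly p y * exp (- y)\<close>
  as \<open>y\<close> tends to infinity.\<close>

lemma flat_tendsto_0: "(flat p \<longlongrightarrow> 0) (at_right 0)"
proof -
  have mono: "((\<lambda>y::real. y ^ k * exp (- y)) \<longlongrightarrow> 0) at_top" for k
    using tendsto_power_div_exp_0[of k] by (simp add: exp_minus field_simps)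
  have "((\<lambda>y. poly p y * exp (- y)) \<longlongrightarrow> 0) at_top"
  proof -
    have "((\<lambda>y. \<Sum>i\<le>degree p. coeff p i * (y ^ i * exp (- y))) \<longlongrightarrow> (\<Sum>i\<le>degree p. coeff p i * 0)) at_top"
      by (intro tendsto_intros mono)
    then show ?thesis by (simp add: poly_altdef sum_distrib_right mult.assoc)
  qed
  then have "((\<lambda>x. poly p (inverse x) * exp (- inverse x)) \<longlongrightarrow> 0) (at_right 0)"
    by (rule filterlim_compose) (rule filterlim_inverse_at_top_right)
  then show ?thesis
    by (rule Lim_transform_eventually)
      (auto simp: eventually_at_right_field flat_def inverse_eq_divide intro: exI[of _ 1])
qed

text \<open>The chain rule with \<open>y = 1 / x\<close> gives
  \<open>y\<^sup>2 * (p - p') * exp (- y)\<close>, and \<open>[:0, 0, 1:]\<close> is the polynomial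
  \<open>y\<^sup>2\<close>. At the origin both one-sided difference quotients tend to 0.\<close>

lemma flat_has_deriv:
  "(flat p has_field_derivative flat ([:0, 0, 1:] * (p - pderiv p)) x) (at x)"
proof -
  consider "x > 0" | "x < 0" | "x = 0" by linarith
  then show ?thesis
  proof cases
    case 1
    have "((\<lambda>x. poly p (1 / x) * exp (- (1 / x))) has_field_derivative
        flat ([:0, 0, 1:] * (p - pderiv p)) x) (at x)"
      using 1 by (auto intro!: derivative_eq_intros DERIV_chain2[OF poly_DERIV]
          simp: flat_def field_simps power2_eq_square)
    then show ?thesis
      by (rule has_field_derivative_transform_within_open[of _ _ _ "{0<..}"])
        (use 1 in \<open>auto simp: flat_def\<close>)
  next
    case 2
    have "((\<lambda>x. 0) has_field_derivative flat ([:0, 0, 1:] * (p - pderiv p)) x) (at x)"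
      using 2 by (simp add: flat_def)
    then show ?thesis
      by (rule has_field_derivative_transform_within_open[of _ _ _ "{..<0}"])
        (use 2 in \<open>auto simp: flat_def\<close>)
  next
    case 3
    \<comment> \<open>For \<open>h > 0\<close> the difference quotient is itself a
      \<open>flat\<close> function, with the polynomial multiplied by its variable.\<close>
    have "((\<lambda>h. flat p h / h) \<longlongrightarrow> 0) (at_right 0)"
      using flat_tendsto_0[of "[:0, 1:] * p"]
      by (rule Lim_transform_eventually)
        (auto simp: eventually_at_right_field flat_def field_simps intro: exI[of _ 1])
    moreover have "((\<lambda>h. flat p h / h) \<longlongrightarrow> 0) (at_left 0)"
      by (rule Lim_transform_eventually[OF tendsto_const])
        (auto simp: eventually_at_left_field flat_def intro: exI[of _ "-1"])
    ultimately have "((\<lambda>h. flat p h / h) \<longlongrightarrow> 0) (at 0)"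
      by (simp add: filterlim_split_at)
    then show ?thesis
      using 3 by (simp add: has_field_derivative_iff flat_def)
  qed
qed

lemma smooth_flat: "smooth (flat p)"
proof -
  have "smooth_upto n (flat p)" for n p
  proof (induction n arbitrary: p)
    case 0
    then show ?case 
      by (auto simp: smooth_upto_0 differentiable_on_def real_differentiable_def intro: flat_has_deriv)
  next
    case (Suc n)
    show ?case by (rule smooth_upto_SucI[OF flat_has_deriv Suc])
  qed
  then show ?thesis by (simp add: smooth_iff_upto)
qed

text \<open>For \<open>n > 0\<close> this is
  \<open>exp (- 1 / (n * (x - a)) - 1 / (n * (b - x)))\<close> on \<open>{a<..<b}\<close> and 0
  elsewhere. Large \<open>n\<close> brings it close to the indicator of the open interval.\<close>

definition bump :: "real \<Rightarrow> real \<Rightarrow> real \<Rightarrow> real \<Rightarrow> real"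
  where "bump n a b x = flat 1 (n * x - n * a) * flat 1 (n * b - n * x)"

lemma smooth_bump: "smooth (bump n a b)"
  using smooth_mult[OF smooth_affine[OF smooth_flat, of 1 n "- n * a"] smooth_affine[OF smooth_flat, of 1 "- n" "n * b"]]
  by (simp add: bump_def[abs_def])

section \<open>Locally integrable functions\<close>

text \<open>Integrability is required on compact intervals of the whole line, not only of the
  negative half-line, so that primitives can be based at 0. Functions given on the half-line enter
  through \<open>ext0\<close>.\<close>

definition locint :: "(real \<Rightarrow> real) \<Rightarrow> bool"
  where "locint v \<longleftrightarrow> (\<forall>a b. v absolutely_integrable_on {a..b})"

lemma locint_on: "locint v \<Longrightarrow> v absolutely_integrable_on {a..b}"
  by (simp add: locint_def)

lemma locint_integrable_on: "locint v \<Longrightarrow> v integrable_on {a..b}"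
  by (simp add: locint_def absolutely_integrable_on_def)

lemma absolutely_integrable_continuous_mult:
  fixes f g :: "real \<Rightarrow> real"
  assumes "continuous_on {a..b} f" "g absolutely_integrable_on {a..b}"
  shows "(\<lambda>x. f x * g x) absolutely_integrable_on {a..b}"
  using assms
  by (intro absolutely_integrable_bounded_measurable_product_real continuous_imp_measurable_on_sets_lebesgue
      compact_imp_bounded compact_continuous_image) auto

lemma locint_continuous_mult:
  "continuous_on UNIV f \<Longrightarrow> locint g \<Longrightarrow> locint (\<lambda>x. f x * g x)"
  unfolding locint_def by (blast intro: absolutely_integrable_continuous_mult continuous_on_subset)

lemma locint_continuous: "continuous_on UNIV f \<Longrightarrow> locint f"
  unfolding locint_def by (blast intro: absolutely_integrable_continuous_real continuous_on_subset)

lemma locint_add: "locint f \<Longrightarrow> locint g \<Longrightarrow> locint (\<lambda>x. f x + g x)"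
  by (simp add: locint_def set_integral_add)

lemma locint_diff: "locint f \<Longrightarrow> locint g \<Longrightarrow> locint (\<lambda>x. f x - g x)"
  by (simp add: locint_def set_integral_diff)

text \<open>Here \<open>F\<close> need not be differentiable anywhere. The defect \<open>\<Phi>\<close> of the formula
  satisfies \<open>\<bar>\<Phi> t - \<Phi> s\<bar> \<le> 2 B \<bar>t - s\<bar> \<bar>A t - A s\<bar>\<close> with \<open>A\<close> the indefinite integral of
  \<open>\<bar>f\<bar>\<close>; as \<open>A\<close> is continuous, the derivative of \<open>\<Phi>\<close> vanishes.\<close>

lemma integral_by_parts_indefinite:
  fixes f F w w' :: "real \<Rightarrow> real"
  assumes f: "f absolutely_integrable_on {a..b}" and ab: "a \<le> b"
    and F: "\<And>t. t \<in> {a..b} \<Longrightarrow> F t = F a + integral {a..t} f"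
    and w: "\<And>t. t \<in> {a..b} \<Longrightarrow> (w has_field_derivative w' t) (at t within {a..b})"
    and w': "continuous_on {a..b} w'"
  shows "integral {a..b} (\<lambda>t. f t * w t)
    = F b * w b - F a * w a - integral {a..b} (\<lambda>t. F t * w' t)"
proof -
  have fi: "f integrable_on {a..b}" and nfi: "(\<lambda>t. \<bar>f t\<bar>) integrable_on {a..b}"
    using f by (auto simp: absolutely_integrable_on_def)
  have Fc: "continuous_on {a..b} F"
    by (subst continuous_on_cong[OF refl F])
      (auto intro!: continuous_intros indefinite_integral_continuous_1 fi)
  have wc: "continuous_on {a..b} w"
    using w by (meson DERIV_continuous continuous_on_eq_continuous_within)
  obtain B where B: "\<And>t. t \<in> {a..b} \<Longrightarrow> \<bar>w' t\<bar> \<le> B"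
    using compact_imp_bounded[OF compact_continuous_image[OF w' compact_Icc]]
    by (force simp: bounded_iff)
  have "(\<lambda>t. w t * f t) absolutely_integrable_on {a..b}"
    by (rule absolutely_integrable_continuous_mult[OF wc f])
  then have fw: "(\<lambda>t. f t * w t) integrable_on {a..b}"
    by (simp add: absolutely_integrable_on_def mult.commute)
  have Fw': "(\<lambda>t. F t * w' t) integrable_on {a..b}"
    by (intro integrable_continuous_real continuous_intros Fc w')
  define h where "h t = f t * w t + F t * w' t" for t
  have h: "h integrable_on {a..b}"
    unfolding h_def by (intro integrable_add fw Fw')
  define \<Phi> where "\<Phi> t = integral {a..t} h - F t * w t" for t
  define A where "A t = integral {a..t} (\<lambda>r. \<bar>f r\<bar>)" for t
  have step: "\<bar>\<Phi> t - \<Phi> s\<bar> \<le> 2 * B * \<bar>t - s\<bar> * \<bar>A t - A s\<bar>"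
    if st: "s \<in> {a..b}" "t \<in> {a..b}" "s \<le> t" for s t
  proof -
    have sub: "{s..t} \<subseteq> {a..b}" using st by auto
    have comb: "integral {a..t} g - integral {a..s} g = integral {s..t} g"
      if "g integrable_on {a..b}" for g :: "real \<Rightarrow> real"
      using Henstock_Kurzweil_Integration.integral_combine[of a s t g] st
        integrable_on_subinterval[OF that, of a t] by auto
    have int_st: "g integrable_on {s..t}" if "g integrable_on {a..b}" for g :: "real \<Rightarrow> real"
      using integrable_on_subinterval[OF that sub] .
    have dF: "F t - F s = integral {s..t} f"
      using F[OF st(1)] F[OF st(2)] comb[OF fi] by linarith
    have dw: "w t - w s = integral {s..t} w'"
    proof -
      have "(w has_vector_derivative w' x) (at x within {s..t})" if "x \<in> {s..t}" for x
        using DERIV_subset[OF w sub] that sub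
        by (auto simp flip: has_real_derivative_iff_has_vector_derivative)
      then have "(w' has_integral w t - w s) {s..t}"
        using st by (intro fundamental_theorem_of_calculus) auto
      then show ?thesis by (simp add: integral_unique)
    qed
    have w'st: "w' integrable_on {s..t}"
      by (rule int_st[OF integrable_continuous_real[OF w']])
    \<comment> \<open>The increment of \<open>F * w\<close> is
      \<open>w t * (F t - F s) + F s * (w t - w s)\<close>. Subtracting it under the integral leaves
      two products, each with one factor that is small on \<open>{s..t}\<close>.\<close>
    let ?k = "\<lambda>r. f r * (w r - w t) + (F r - F s) * w' r"
    have k: "?k = (\<lambda>r. h r - (w t * f r + F s * w' r))"
      by (auto simp: h_def algebra_simps)
    have kint: "?k integrable_on {s..t}"
      unfolding k by (intro integrable_diff integrable_add int_st h integrable_on_mult_right fi w'st)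
    have "\<Phi> t - \<Phi> s = integral {s..t} h - (w t * (F t - F s) + F s * (w t - w s))"
      using comb[OF h] by (simp add: \<Phi>_def algebra_simps)
    also have "\<dots> = integral {s..t} ?k"
      unfolding k dF dw using int_st[OF h] int_st[OF fi] w'st
      by (simp add: integral_diff integral_add integrable_add integrable_on_mult_right)
    finally have eq: "\<Phi> t - \<Phi> s = integral {s..t} ?k" .
    let ?A = "A t - A s"
    have A: "?A = integral {s..t} (\<lambda>r. \<bar>f r\<bar>)"
      unfolding A_def by (rule comb[OF nfi])
    have bd: "norm (?k r) \<le> \<bar>f r\<bar> * (B * (t - s)) + ?A * B" if r: "r \<in> {s..t}" for r
    proof -
      have rab: "r \<in> {a..b}" using r sub by auto
      have B0: "0 \<le> B" using B[OF rab] by linarith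
      \<comment> \<open>Mean value inequality on the convex set \<open>{a..b}\<close>, where
        \<open>\<bar>w'\<bar> \<le> B\<close>.\<close>
      have "norm (w r - w t) \<le> B * norm (r - t)"
        using rab st B by (intro field_differentiable_bound[of "{a..b}" w w'] w) auto
      also have "\<dots> \<le> B * (t - s)" using r B0 by (intro mult_left_mono) auto
      finally have 1: "\<bar>w r - w t\<bar> \<le> B * (t - s)" by simp
      have "F r - F s = integral {s..r} f"
        using F[OF rab] F[of s] st r
          Henstock_Kurzweil_Integration.integral_combine[of a s r f]
          integrable_on_subinterval[OF fi, of a r] by auto
      also have "norm \<dots> \<le> integral {s..r} (\<lambda>r. \<bar>f r\<bar>)"
        using r sub integrable_on_subinterval[OF fi, of s r] integrable_on_subinterval[OF nfi, of s r]
        by (intro integral_norm_bound_integral) auto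
      also have "\<dots> \<le> ?A"
        unfolding A using r sub int_st[OF nfi] integrable_on_subinterval[OF nfi, of s r]
        by (intro integral_subset_le) auto
      finally have 2: "\<bar>F r - F s\<bar> \<le> ?A" by simp
      then have A0: "0 \<le> ?A" by linarith
      have "norm (?k r) \<le> \<bar>f r\<bar> * \<bar>w r - w t\<bar> + \<bar>F r - F s\<bar> * \<bar>w' r\<bar>"
        by (metis abs_mult abs_triangle_ineq real_norm_def)
      also have "\<dots> \<le> \<bar>f r\<bar> * (B * (t - s)) + ?A * B"
        using 1 2 B[OF rab] A0 by (intro add_mono mult_mono) auto
      finally show ?thesis .
    qed
    have "norm (integral {s..t} ?k) \<le> integral {s..t} (\<lambda>r. \<bar>f r\<bar> * (B * (t - s)) + ?A * B)"
      using bd int_st[OF nfi]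
      by (intro integral_norm_bound_integral kint integrable_add integrable_on_mult_left) auto
    also have "\<dots> = ?A * (B * (t - s)) + (t - s) * (?A * B)"
      using int_st[OF nfi] st
      by (subst integral_add) (auto simp: integrable_on_mult_left A)
    also have "\<dots> \<le> 2 * B * \<bar>t - s\<bar> * \<bar>?A\<bar>"
      using st integral_nonneg[OF int_st[OF nfi]] by (simp add: A)
    finally show ?thesis using eq by simp
  qed
  have step': "\<bar>\<Phi> t - \<Phi> s\<bar> \<le> 2 * B * \<bar>t - s\<bar> * \<bar>A t - A s\<bar>"
    if "s \<in> {a..b}" "t \<in> {a..b}" for s t
    using step[of s t] step[of t s] that by (cases "s \<le> t") (auto simp: abs_minus_commute)
  have Ac: "continuous_on {a..b} A"
    unfolding A_def by (rule indefinite_integral_continuous_1[OF nfi])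
  have "(\<Phi> has_field_derivative 0) (at x within {a..b})" if x: "x \<in> {a..b}" for x
    unfolding has_field_derivative_iff
  proof (rule Lim_null_comparison)
    show "\<forall>\<^sub>F y in at x within {a..b}. norm ((\<Phi> y - \<Phi> x) / (y - x)) \<le> 2 * B * \<bar>A y - A x\<bar>"
      unfolding eventually_at_filter
    proof (rule always_eventually, intro allI impI)
      fix y assume "y \<noteq> x" "y \<in> {a..b}"
      then show "norm ((\<Phi> y - \<Phi> x) / (y - x)) \<le> 2 * B * \<bar>A y - A x\<bar>"
        using step'[OF x, of y] by (simp add: abs_divide divide_le_eq mult_ac)
    qed
    have "((\<lambda>y. 2 * B * \<bar>A y - A x\<bar>) \<longlongrightarrow> 2 * B * \<bar>A x - A x\<bar>) (at x within {a..b})"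
      using Ac x by (intro tendsto_intros) (auto simp: continuous_on)
    then show "((\<lambda>y. 2 * B * \<bar>A y - A x\<bar>) \<longlongrightarrow> 0) (at x within {a..b})" by simp
  qed
  then obtain c where "\<forall>x\<in>{a..b}. \<Phi> x = c"
    using has_field_derivative_zero_constant[of "{a..b}" \<Phi>] by auto
  then have "\<Phi> b = \<Phi> a" using ab by auto
  then show ?thesis
    using fw Fw' by (simp add: \<Phi>_def h_def[abs_def] integral_add)
qed

section \<open>Test functions and the lemma of du Bois-Reymond\<close>

lemma flat_1: "flat 1 x = (if x > 0 then exp (- (1 / x)) else 0)"
  by (simp add: flat_def)

lemma flat_1_bounds: "0 \<le> flat 1 x" "flat 1 x \<le> 1"
  by (auto simp: flat_1)

lemma bump_bounds: "0 \<le> bump n a b x" "bump n a b x \<le> 1"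
  using flat_1_bounds by (auto simp: bump_def mult_le_one)

lemma bump_eq_0: "n > 0 \<Longrightarrow> x \<notin> {a<..<b} \<Longrightarrow> bump n a b x = 0"
  by (auto simp: bump_def flat_1 not_less)

lemma bump_pos: "n > 0 \<Longrightarrow> x \<in> {a<..<b} \<Longrightarrow> bump n a b x > 0"
  by (auto simp: bump_def flat_1)

text \<open>Inside the interval both exponents are of size \<open>1 / n\<close>; outside it one
  factor vanishes for every \<open>n\<close>. The shift to \<open>Suc n\<close> keeps the scale
  positive.\<close>

lemma bump_tendsto: "(\<lambda>n. bump (real (Suc n)) a b x) \<longlonglongrightarrow> indicator {a<..<b} x"
proof (cases "x \<in> {a<..<b}")
  case True
  have "(\<lambda>n. exp (- (inverse (real (Suc n)) * inverse (x - a)))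
      * exp (- (inverse (real (Suc n)) * inverse (b - x))))
      \<longlonglongrightarrow> exp (- (0 * inverse (x - a))) * exp (- (0 * inverse (b - x)))"
    by (intro tendsto_intros LIMSEQ_inverse_real_of_nat)
  moreover have "bump (real (Suc n)) a b x = exp (- (inverse (real (Suc n)) * inverse (x - a)))
      * exp (- (inverse (real (Suc n)) * inverse (b - x)))" for n
  proof -
    have "real (Suc n) * x - real (Suc n) * a = real (Suc n) * (x - a)"
      "real (Suc n) * b - real (Suc n) * x = real (Suc n) * (b - x)"
      by (simp_all only: right_diff_distrib)
    with True show ?thesis
      unfolding bump_def flat_1 by (simp del: of_nat_Suc add: divide_inverse)
  qed
  ultimately show ?thesis using True by simp
next
  case False
  then have "bump (real (Suc n)) a b x = 0" for n
    by (intro bump_eq_0) auto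
  then show ?thesis using False by simp
qed

lemma deriv_eq_0_outside:
  assumes "\<And>z. z \<notin> {a..b} \<Longrightarrow> \<phi> z = (0::real)" "z \<notin> {a..b}"
  shows "deriv \<phi> z = 0"
proof -
  have "((\<lambda>z. 0) has_field_derivative 0) (at z)" by simp
  then have "(\<phi> has_field_derivative 0) (at z)"
    by (rule has_field_derivative_transform_within_open[of _ _ _ "- {a..b}"])
      (use assms in auto)
  then show ?thesis by (rule DERIV_imp_deriv)
qed

text \<open>The compact support is replaced by the interval from its minimum to its maximum, which
  suits integration over intervals.\<close>

lemma test_fun_iff:
  "test_fun \<phi> \<longleftrightarrow> smooth \<phi> \<and> (\<exists>a b. a < b \<and> b < 0 \<and> (\<forall>z. z \<notin> {a..b} \<longrightarrow> \<phi> z = 0))"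
proof
  assume "test_fun \<phi>"
  then obtain K where K: "compact K" "K \<subseteq> {..<0}" "\<And>z. z \<notin> K \<Longrightarrow> \<phi> z = 0" and "smooth \<phi>"
    by (auto simp: test_fun_def smooth_def)
  \<comment> \<open>The two extra points make the set nonempty and force \<open>a < b\<close>, even
    if \<open>K\<close> is empty or a single point.\<close>
  let ?K = "insert (-1) (insert (-2) K)"
  have K': "compact ?K" "?K \<noteq> {}" using K by auto
  obtain a where a: "a \<in> ?K" "\<And>z. z \<in> ?K \<Longrightarrow> a \<le> z"
    using compact_attains_inf[OF K'] by blast
  obtain b where b: "b \<in> ?K" "\<And>z. z \<in> ?K \<Longrightarrow> z \<le> b"
    using compact_attains_sup[OF K'] by blast
  have "a \<le> -2" "-1 \<le> b" using a b by auto
  moreover have "b < 0" using b(1) K(2) by auto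
  moreover have "\<phi> z = 0" if "z \<notin> {a..b}" for z
    using that a(2)[of z] b(2)[of z] K(3)[of z] by auto
  ultimately show "smooth \<phi> \<and> (\<exists>a b. a < b \<and> b < 0 \<and> (\<forall>z. z \<notin> {a..b} \<longrightarrow> \<phi> z = 0))"
    using \<open>smooth \<phi>\<close> by (intro conjI exI[of _ a] exI[of _ b]) auto
next
  assume "smooth \<phi> \<and> (\<exists>a b. a < b \<and> b < 0 \<and> (\<forall>z. z \<notin> {a..b} \<longrightarrow> \<phi> z = 0))"
  then obtain a b where "smooth \<phi>" "b < 0" "\<forall>z. z \<notin> {a..b} \<longrightarrow> \<phi> z = 0" by blast
  then show "test_fun \<phi>"
    unfolding test_fun_def smooth_def by (intro conjI exI[of _ "{a..b}"]) auto
qed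

lemma test_fun_smooth: "test_fun \<phi> \<Longrightarrow> smooth \<phi>"
  by (simp add: test_fun_iff)

lemma test_fun_has_deriv: "test_fun \<phi> \<Longrightarrow> (\<phi> has_field_derivative deriv \<phi> x) (at x)"
  by (simp add: smooth_has_deriv test_fun_smooth)

lemma test_fun_continuous_on: "test_fun \<phi> \<Longrightarrow> continuous_on A \<phi>"
  by (simp add: smooth_continuous_on test_fun_smooth)

lemma test_fun_deriv: "test_fun \<phi> \<Longrightarrow> test_fun (deriv \<phi>)"
  unfolding test_fun_iff using smooth_deriv deriv_eq_0_outside by blast

lemma test_fun_bump: "n > 0 \<Longrightarrow> a < b \<Longrightarrow> b < 0 \<Longrightarrow> test_fun (bump n a b)"
  unfolding test_fun_iff
  by (intro conjI exI[of _ a] exI[of _ b]) (auto simp: smooth_bump intro!: bump_eq_0)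

lemma test_fun_add_scale:
  assumes "test_fun \<phi>" "test_fun \<psi>"
  shows "test_fun (\<lambda>z. \<phi> z + c * \<psi> z)"
proof -
  obtain a b a' b' where *: "a < b" "b < 0" "\<forall>z. z \<notin> {a..b} \<longrightarrow> \<phi> z = 0"
    "a' < b'" "b' < 0" "\<forall>z. z \<notin> {a'..b'} \<longrightarrow> \<psi> z = 0"
    using assms unfolding test_fun_iff by blast
  then have "\<exists>a b. a < b \<and> b < 0 \<and> (\<forall>z. z \<notin> {a..b} \<longrightarrow> \<phi> z + c * \<psi> z = 0)"
    by - (rule exI[of _ "min a a'"], rule exI[of _ "max b b'"],
        auto simp: min_le_iff_disj le_max_iff_disj)
  then show ?thesis
    using assms by (simp add: test_fun_iff smooth_add smooth_mult smooth_const)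
qed

text \<open>This is the bridge between the Lebesgue integral over the half-line, used for
  distributions and inner products, and the gauge integral over a compact interval, used for
  calculus.\<close>

lemma neg_integral_support:
  fixes f :: "real \<Rightarrow> real"
  assumes f: "f absolutely_integrable_on {a..b}" and "b < 0"
    and out: "\<And>z. z \<notin> {a..b} \<Longrightarrow> f z = 0"
  shows "integrable neg_leb f" "integral\<^sup>L neg_leb f = integral {a..b} f"
proof -
  have "(\<lambda>z. if z \<in> {a..b} then f z else 0) = f" using out by auto
  then have "f absolutely_integrable_on UNIV"
    using absolutely_integrable_restrict_UNIV[of "{a..b}" f] f by simp
  then have "f absolutely_integrable_on {..<0}"
    by (rule set_integrable_subset) auto
  then show "integrable neg_leb f"
    by (simp add: set_integrable_def integrable_restrict_space)
  then have "integral\<^sup>L neg_leb f = integral {..<0} f"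
    by (simp add: lebesgue_integral_eq_integral)
  also have "\<dots> = integral {a..b} f"
  proof (rule integral_spike_set)
    have "{z \<in> {..<0} - {a..b}. f z \<noteq> 0} = {}" using out by auto
    then show "negligible {z \<in> {..<0} - {a..b}. f z \<noteq> 0}" by (simp only: negligible_empty)
    have "{z \<in> {a..b} - {..<0}. f z \<noteq> 0} = {}" using \<open>b < 0\<close> by auto
    then show "negligible {z \<in> {a..b} - {..<0}. f z \<noteq> 0}" by (simp only: negligible_empty)
  qed
  finally show "integral\<^sup>L neg_leb f = integral {a..b} f" .
qed

lemma locint_test_integrable:
  assumes v: "locint v" and \<phi>: "test_fun \<phi>"
  shows "integrable neg_leb (\<lambda>z. v z * \<phi> z)"
proof -
  obtain a b where ab: "b < 0" "\<And>z. z \<notin> {a..b} \<Longrightarrow> \<phi> z = 0"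
    using \<phi> unfolding test_fun_iff by blast
  have "(\<lambda>z. \<phi> z * v z) absolutely_integrable_on {a..b}"
    by (intro absolutely_integrable_continuous_mult test_fun_continuous_on \<phi> locint_on v)
  then show ?thesis
    by (intro neg_integral_support(1)[where a = a and b = b]) (auto simp: ab mult.commute)
qed

section \<open>Locally integrable functions are determined by testing\<close>

text \<open>By Lebesgue differentiation, outside a null set \<open>v z\<close> is the limit of the
  averages of \<open>v\<close> over \<open>{z..z+h}\<close>, and these vanish.\<close>

lemma integral_zero_imp_AE_zero:
  assumes v: "locint v" and zero: "\<And>a b. a < b \<Longrightarrow> b < 0 \<Longrightarrow> integral {a..b} v = 0"
  shows "negligible {z. z < 0 \<and> v z \<noteq> 0}"
proof -
  obtain N where N: "negligible N"
    "\<And>x e. \<lbrakk>x \<notin> N; 0 < e\<rbrakk> \<Longrightarrow> \<exists>d>0. \<forall>h. 0 < h \<and> h < d \<longrightarrow>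
        norm (integral (cbox x (x + h *\<^sub>R One)) v /\<^sub>R h ^ DIM(real) - v x) < e"
    using integrable_ccontinuous_explicit[of v] locint_integrable_on[OF v] by (auto simp: cbox_interval)
  have "v z = 0" if z: "z < 0" "z \<notin> N" for z
  proof (rule ccontr)
    assume "v z \<noteq> 0"
    then obtain d where d: "d > 0" "\<And>h. 0 < h \<Longrightarrow> h < d \<Longrightarrow> norm (integral {z..z+h} v / h - v z) < \<bar>v z\<bar>"
      using N(2)[OF z(2), of "\<bar>v z\<bar>"] by (auto simp: cbox_interval divide_inverse mult.commute)
    \<comment> \<open>Smaller than \<open>d\<close>, and small enough to keep
      \<open>{z..z+h}\<close> inside the negative half-line.\<close>
    define h where "h = min d (-z) / 2"
    have h: "0 < h" "h < d" "z + h < 0"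
      using d z by (auto simp: h_def)
    have "integral {z..z+h} v = 0"
      using h by (intro zero) auto
    then show False using d(2)[OF h(1,2)] by simp
  qed
  then have "{z. z < 0 \<and> v z \<noteq> 0} \<subseteq> N" by auto
  then show ?thesis using N(1) negligible_subset by blast
qed

text \<open>Bumps converge pointwise to the indicator of an interval and are bounded by 1, so
  dominated convergence with majorant \<open>\<bar>v\<bar>\<close> turns vanishing tests into
  vanishing integrals over intervals.\<close>

lemma weak_zero_imp_AE_zero:
  assumes v: "locint v" and zero: "\<And>\<phi>. test_fun \<phi> \<Longrightarrow> (\<integral>z. v z * \<phi> z \<partial>neg_leb) = 0"
  shows "negligible {z. z < 0 \<and> v z \<noteq> 0}"
proof (rule integral_zero_imp_AE_zero[OF v])
  fix a b :: real assume ab: "a < b" "b < 0"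
  let ?\<phi> = "\<lambda>n. bump (real (Suc n)) a b"
  have ai: "(\<lambda>z. v z * ?\<phi> n z) absolutely_integrable_on {a..b}" for n
    using absolutely_integrable_continuous_mult[OF smooth_continuous_on[OF smooth_bump] locint_on[OF v]]
    by (simp add: mult.commute)
  have 0: "integral {a..b} (\<lambda>z. v z * ?\<phi> n z) = 0" for n
  proof -
    have "v z * ?\<phi> n z = 0" if "z \<notin> {a..b}" for z
      using that bump_eq_0[of "real (Suc n)" z a b] by auto
    then show ?thesis
      using neg_integral_support(2)[OF ai ab(2)] zero[OF test_fun_bump[OF _ ab, of "real (Suc n)"]]
      by simp
  qed
  have "(\<lambda>n. integral {a..b} (\<lambda>z. v z * ?\<phi> n z)) \<longlonglongrightarrow>
      integral {a..b} (\<lambda>z. v z * indicator {a<..<b} z)"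
  proof (rule dominated_convergence(2))
    show "(\<lambda>z. v z * ?\<phi> n z) integrable_on {a..b}" for n
      using ai by (simp add: absolutely_integrable_on_def)
    show "(\<lambda>z. \<bar>v z\<bar>) integrable_on {a..b}"
      using locint_on[OF v] by (simp add: absolutely_integrable_on_def)
    show "norm (v z * ?\<phi> n z) \<le> \<bar>v z\<bar>" for n z
      using bump_bounds[of "real (Suc n)" a b z]
      by (simp add: abs_mult mult_left_le del: of_nat_Suc)
    show "(\<lambda>n. v z * ?\<phi> n z) \<longlonglongrightarrow> v z * indicator {a<..<b} z" for z
      by (intro tendsto_intros bump_tendsto)
  qed
  then have "integral {a..b} (\<lambda>z. v z * indicator {a<..<b} z) = 0"
    unfolding 0 by (simp add: LIMSEQ_const_iff)
  moreover have "integral {a..b} (\<lambda>z. v z * indicator {a<..<b} z) = integral {a..b} v"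
    by (rule integral_spike[of "{a, b}"]) (auto simp: indicator_def)
  ultimately show "integral {a..b} v = 0" by simp
qed

text \<open>The primitive that starts at the left end of the support vanishes beyond the right end
  because the mean is zero.\<close>

lemma test_fun_antiderivative:
  assumes \<psi>: "test_fun \<psi>" and mean: "(\<integral>z. \<psi> z \<partial>neg_leb) = 0"
  obtains \<phi> where "test_fun \<phi>" "deriv \<phi> = \<psi>"
proof -
  obtain a b where ab: "a < b" "b < 0" "\<And>z. z \<notin> {a..b} \<Longrightarrow> \<psi> z = 0"
    using \<psi> unfolding test_fun_iff by blast
  have int: "\<psi> absolutely_integrable_on {s..t}" for s t
    by (intro absolutely_integrable_continuous_real test_fun_continuous_on \<psi>)
  have int': "\<psi> integrable_on {s..t}" for s t
    using int by (simp add: absolutely_integrable_on_def)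
  have zero: "integral {a..b} \<psi> = 0"
    using neg_integral_support(2)[OF int ab(2,3)] mean by simp
  define \<phi> where "\<phi> z = integral {a..z} \<psi>" for z
  \<comment> \<open>Moving the lower limit to the left of \<open>a\<close> adds only zeros. Taking
    it below \<open>z\<close> as well makes \<open>z\<close> an interior point for the fundamental
    theorem of calculus, also when \<open>z \<le> a\<close>.\<close>
  have shift: "\<phi> z = integral {l..z} \<psi>" if "l < a" for l z
    unfolding \<phi>_def
    by (rule integral_spike_set; rule negligible_subset[of "{}"]) (use that ab in auto)
  have deriv: "(\<phi> has_field_derivative \<psi> z) (at z)" for z
  proof -
    define l where "l = min a z - 1"
    have "((\<lambda>z. integral {l..z} \<psi>) has_real_derivative \<psi> z) (at z within {l..z+1})"
      by (rule integral_has_real_derivative) (auto simp: l_def intro: test_fun_continuous_on \<psi>)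
    then have "((\<lambda>z. integral {l..z} \<psi>) has_real_derivative \<psi> z) (at z)"
      by (subst (asm) at_within_Icc_at) (auto simp: l_def)
    moreover have "\<phi> = (\<lambda>z. integral {l..z} \<psi>)"
      by (rule ext, rule shift) (simp add: l_def)
    ultimately show ?thesis by simp
  qed
  have "\<phi> z = 0" if "z \<notin> {a..b}" for z
  proof (cases "z < a")
    case True
    then show ?thesis by (simp add: \<phi>_def)
  next
    case False
    then have bz: "b < z" using that by auto
    have "\<phi> z = integral {a..b} \<psi>"
      unfolding \<phi>_def
      by (rule integral_spike_set; rule negligible_subset[of "{}"]) (use ab bz in auto)
    then show ?thesis using zero by simp
  qed
  moreover have "smooth \<phi>"
    using deriv test_fun_smooth[OF \<psi>] by (rule smoothI)
  ultimately have "test_fun \<phi>"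
    using ab unfolding test_fun_iff by blast
  moreover have "deriv \<phi> = \<psi>"
    using deriv DERIV_imp_deriv by blast
  ultimately show thesis by (rule that)
qed

text \<open>Subtracting from \<open>\<psi>\<close> a multiple of a fixed bump \<open>\<eta>\<close>
  of nonzero mean leaves a test function of mean zero. That is the derivative of a test function, so
  \<open>L\<close> annihilates it, and \<open>L \<psi>\<close> is determined by
  \<open>L \<eta>\<close>.\<close>

lemma annihilates_derivs_imp_multiple_of_integral:
  assumes lin: "\<And>\<phi> \<psi> c. test_fun \<phi> \<Longrightarrow> test_fun \<psi> \<Longrightarrow> L (\<lambda>z. \<phi> z + c * \<psi> z) = L \<phi> + c * L \<psi>"
    and zero: "\<And>\<phi>. test_fun \<phi> \<Longrightarrow> L (deriv \<phi>) = (0::real)"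
  shows "\<exists>c. \<forall>\<psi>. test_fun \<psi> \<longrightarrow> L \<psi> = c * (\<integral>z. \<psi> z \<partial>neg_leb)"
proof -
  have int: "integrable neg_leb \<psi>" if "test_fun \<psi>" for \<psi>
    using locint_test_integrable[OF locint_continuous[OF continuous_on_const, of 1] that] by simp
  define \<eta> where "\<eta> = bump 1 (-2) (-1)"
  have \<eta>: "test_fun \<eta>" unfolding \<eta>_def by (intro test_fun_bump) auto
  have m: "(\<integral>z. \<eta> z \<partial>neg_leb) \<noteq> 0"
  proof
    assume "(\<integral>z. \<eta> z \<partial>neg_leb) = 0"
    moreover have "\<eta> absolutely_integrable_on {-2..-1}"
      by (intro absolutely_integrable_continuous_real test_fun_continuous_on \<eta>)
    moreover have "\<eta> z = 0" if "z \<notin> {-2..-1}" for z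
      using that bump_eq_0[of 1 z "-2" "-1"] by (auto simp: \<eta>_def)
    ultimately have "integral {-2..-1} \<eta> = 0"
      using neg_integral_support(2)[where f = \<eta> and a = "-2" and b = "-1"] by simp
    moreover have "\<eta> integrable_on {-2..-1}"
      by (intro integrable_continuous_real test_fun_continuous_on \<eta>)
    \<comment> \<open>A nonnegative continuous function with integral 0 vanishes identically on the
      interval, but the bump is positive at the midpoint.\<close>
    ultimately have "(\<eta> has_integral 0) (cbox (-2) (-1))"
      by (metis has_integral_integral cbox_interval)
    then have "\<eta> (-3/2) = 0"
      by (rule has_integral_0_cbox_imp_0[rotated 2])
        (auto simp: \<eta>_def bump_bounds intro: smooth_continuous_on smooth_bump)
    then show False using bump_pos[of 1 "-3/2" "-2" "-1"] by (simp add: \<eta>_def)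
  qed
  let ?m = "\<lambda>\<psi>. (\<integral>z. \<psi> z \<partial>neg_leb)"
  have "L \<psi> = L \<eta> / ?m \<eta> * ?m \<psi>" if \<psi>: "test_fun \<psi>" for \<psi>
  proof -
    let ?c = "- ?m \<psi> / ?m \<eta>"
    have t: "test_fun (\<lambda>z. \<psi> z + ?c * \<eta> z)" by (rule test_fun_add_scale[OF \<psi> \<eta>])
    have "(\<integral>z. \<psi> z + ?c * \<eta> z \<partial>neg_leb) = 0"
      using m int[OF \<psi>] int[OF \<eta>] by simp
    then obtain \<phi> where "test_fun \<phi>" "deriv \<phi> = (\<lambda>z. \<psi> z + ?c * \<eta> z)"
      using test_fun_antiderivative[OF t] by blast
    then have "L (\<lambda>z. \<psi> z + ?c * \<eta> z) = 0" using zero by metis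
    then show ?thesis using lin[OF \<psi> \<eta>, of ?c] by (simp add: field_simps)
  qed
  then show ?thesis by blast
qed

lemma integral_test_add_scale:
  assumes "locint v" "test_fun \<phi>" "test_fun \<psi>"
  shows "(\<integral>z. v z * (\<phi> z + c * \<psi> z) \<partial>neg_leb)
    = (\<integral>z. v z * \<phi> z \<partial>neg_leb) + c * (\<integral>z. v z * \<psi> z \<partial>neg_leb)"
proof -
  have "(\<integral>z. v z * (\<phi> z + c * \<psi> z) \<partial>neg_leb)
      = (\<integral>z. v z * \<phi> z + c * (v z * \<psi> z) \<partial>neg_leb)"
    by (simp add: algebra_simps)
  then show ?thesis
    using locint_test_integrable[OF assms(1,2)] locint_test_integrable[OF assms(1,3)] by simp
qed

text \<open>Tested against functions, \<open>v\<close> acts like a constant \<open>c\<close>; hence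
  \<open>v - c\<close> is weakly zero.\<close>

lemma du_Bois_Reymond:
  assumes v: "locint v" and zero: "\<And>\<phi>. test_fun \<phi> \<Longrightarrow> (\<integral>z. v z * deriv \<phi> z \<partial>neg_leb) = 0"
  obtains c where "negligible {z. z < 0 \<and> v z \<noteq> c}"
proof -
  define L where "L \<psi> = (\<integral>z. v z * \<psi> z \<partial>neg_leb)" for \<psi>
  have "L (\<lambda>z. \<phi> z + c * \<psi> z) = L \<phi> + c * L \<psi>" if "test_fun \<phi>" "test_fun \<psi>" for \<phi> \<psi> c
    unfolding L_def by (rule integral_test_add_scale[OF v that])
  moreover have "L (deriv \<phi>) = 0" if "test_fun \<phi>" for \<phi>
    unfolding L_def by (rule zero[OF that])
  ultimately have "\<exists>c. \<forall>\<psi>. test_fun \<psi> \<longrightarrow> L \<psi> = c * (\<integral>z. \<psi> z \<partial>neg_leb)"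
    by (rule annihilates_derivs_imp_multiple_of_integral[of L])
  then obtain c where c: "\<And>\<psi>. test_fun \<psi> \<Longrightarrow> L \<psi> = c * (\<integral>z. \<psi> z \<partial>neg_leb)"
    by auto
  have one: "locint (\<lambda>z. k)" for k by (intro locint_continuous continuous_on_const)
  have "negligible {z. z < 0 \<and> v z - c \<noteq> 0}"
  proof (rule weak_zero_imp_AE_zero)
    show "locint (\<lambda>z. v z - c)" by (intro locint_diff v one)
    fix \<psi> assume \<psi>: "test_fun \<psi>"
    have "(\<integral>z. (v z - c) * \<psi> z \<partial>neg_leb) = (\<integral>z. v z * \<psi> z - c * \<psi> z \<partial>neg_leb)"
      by (simp add: left_diff_distrib)
    also have "\<dots> = 0"
      using locint_test_integrable[OF v \<psi>] locint_test_integrable[OF one \<psi>, of c]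
        c[OF \<psi>] by (simp add: L_def)
    finally show "(\<integral>z. (v z - c) * \<psi> z \<partial>neg_leb) = 0" .
  qed
  then show thesis by (intro that) simp
qed

text \<open>The antiderivative vanishing at \<open>0\<close>. For \<open>z > 0\<close> the interval is empty and the value
  is \<open>0\<close>.\<close>

definition indef :: "(real \<Rightarrow> real) \<Rightarrow> real \<Rightarrow> real"
  where "indef v z = - integral {z..0} v"

lemma indef_eq:
  assumes "locint v" "a \<le> t" "t \<le> 0"
  shows "indef v t = indef v a + integral {a..t} v"
  using Henstock_Kurzweil_Integration.integral_combine[of a t 0 v] assms
    locint_integrable_on[of v a 0] by (simp add: indef_def)

lemma continuous_on_indef:
  assumes "locint v"
  shows "continuous_on UNIV (indef v)"
proof -
  have "isCont (indef v) z" for z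
  proof -
    define a where "a = min z 0 - 1"
    define b where "b = max z 0 + 1"
    \<comment> \<open>A single formula for both signs of \<open>t\<close>: the two integrals cancel
      for \<open>t > 0\<close>, and \<open>max 0 t\<close> is 0 for \<open>t \<le> 0\<close>. Each
      of them has a fixed upper limit, so continuity of indefinite integrals applies.\<close>
    have "indef v t = - integral {t..b} v + integral {max 0 t..b} v" if "t \<in> {a..b}" for t
    proof (cases "t \<le> 0")
      case True
      then show ?thesis
        using Henstock_Kurzweil_Integration.integral_combine[of t 0 b v] locint_integrable_on[OF assms]
        by (simp add: indef_def b_def)
    next
      case False
      then show ?thesis by (simp add: indef_def)
    qed
    moreover have "continuous_on {a..b} (\<lambda>t. - integral {t..b} v + integral {max 0 t..b} v)"
    proof -
      have c: "continuous_on {a..b} (\<lambda>t. integral {t..b} v)"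
        by (intro indefinite_integral_continuous_1' locint_integrable_on assms)
      show ?thesis
        by (intro continuous_intros c continuous_on_compose2[OF c, of _ "\<lambda>t. max 0 t"])
          (auto simp: a_def b_def)
    qed
    ultimately have "continuous_on {a..b} (indef v)"
      by (subst continuous_on_cong[OF refl]) auto
    then show ?thesis
      by (rule continuous_on_interior) (auto simp: a_def b_def)
  qed
  then show ?thesis by (simp add: continuous_at_imp_continuous_on)
qed

text \<open>The primitive has \<open>v\<close> as its weak derivative. This is integration by parts
  over the support of \<open>\<phi>\<close>, where the boundary terms vanish.\<close>

lemma indef_test:
  assumes v: "locint v" and \<phi>: "test_fun \<phi>"
  shows "(\<integral>z. v z * \<phi> z \<partial>neg_leb) = - (\<integral>z. indef v z * deriv \<phi> z \<partial>neg_leb)"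
proof -
  obtain a b where ab: "a < b" "b < 0" "\<And>z. z \<notin> {a..b} \<Longrightarrow> \<phi> z = 0"
    using \<phi> unfolding test_fun_iff by blast
  \<comment> \<open>The support property speaks only of points outside \<open>{a..b}\<close>; at the
    endpoints the value is the one-sided limit from outside.\<close>
  have ends: "\<phi> a = 0" "\<phi> b = 0"
  proof -
    have "continuous (at_left a) \<phi>" "continuous (at_right b) \<phi>"
      using DERIV_isCont[OF test_fun_has_deriv[OF \<phi>]] by (auto intro: continuous_at_imp_continuous_at_within)
    then have lim: "(\<phi> \<longlongrightarrow> \<phi> a) (at_left a)" "(\<phi> \<longlongrightarrow> \<phi> b) (at_right b)"
      by (auto simp: continuous_within)
    have "(\<phi> \<longlongrightarrow> 0) (at_left a)"
      by (rule Lim_transform_eventually[OF tendsto_const])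
        (auto simp: eventually_at_left_field ab intro: exI[of _ "a - 1"])
    then show "\<phi> a = 0" using lim(1) tendsto_unique[of "at_left a"] by auto
    have "(\<phi> \<longlongrightarrow> 0) (at_right b)"
      by (rule Lim_transform_eventually[OF tendsto_const])
        (auto simp: eventually_at_right_field ab intro: exI[of _ "b + 1"])
    then show "\<phi> b = 0" using lim(2) tendsto_unique[of "at_right b"] by auto
  qed
  have "integral {a..b} (\<lambda>z. v z * \<phi> z) = indef v b * \<phi> b - indef v a * \<phi> a
      - integral {a..b} (\<lambda>z. indef v z * deriv \<phi> z)"
    using ab v by (intro integral_by_parts_indefinite locint_on indef_eq test_fun_continuous_on
        test_fun_deriv \<phi>) (auto intro: has_field_derivative_at_within test_fun_has_deriv \<phi>)
  moreover have "(\<integral>z. v z * \<phi> z \<partial>neg_leb) = integral {a..b} (\<lambda>z. v z * \<phi> z)"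
    using absolutely_integrable_continuous_mult[OF test_fun_continuous_on[OF \<phi>] locint_on[OF v], of a b] ab
    by (intro neg_integral_support) (auto simp: mult.commute)
  moreover have "(\<integral>z. indef v z * deriv \<phi> z \<partial>neg_leb) = integral {a..b} (\<lambda>z. indef v z * deriv \<phi> z)"
    using deriv_eq_0_outside[OF ab(3)] ab
    by (intro neg_integral_support absolutely_integrable_continuous_real continuous_intros
        continuous_on_subset[OF continuous_on_indef[OF v]] test_fun_continuous_on test_fun_deriv \<phi>) auto
  ultimately show ?thesis by (simp add: ends)
qed

section \<open>Regularity on the maximal domain\<close>

definition ext0 :: "(real \<Rightarrow> real) \<Rightarrow> real \<Rightarrow> real"
  where "ext0 g z = (if z \<in> {..<0} then g z else 0)"

text \<open>On bounded sets square integrability implies integrability, by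
  \<open>\<bar>g\<bar> \<le> 1 + g\<^sup>2\<close>.\<close>

lemma locint_ext0:
  assumes "sq_int g"
  shows "locint (ext0 g)"
  unfolding locint_def
proof (intro allI)
  fix a b :: real
  let ?S = "{..<0} \<inter> {a..b}"
  have m: "g \<in> borel_measurable (lebesgue_on ?S)"
    by (rule measurable_restrict_mono[of g lebesgue "{..<0}"]) (use assms in \<open>auto simp: sq_int_def\<close>)
  have sq: "(\<lambda>z. (g z)\<^sup>2) absolutely_integrable_on {..<0}"
    using assms by (simp add: sq_int_def set_integrable_def integrable_restrict_space)
  have "(\<lambda>z. 1 + (g z)\<^sup>2) integrable_on ?S"
  proof (rule integrable_add)
    have "(\<lambda>z. (g z)\<^sup>2) absolutely_integrable_on ?S"
      by (rule set_integrable_subset[OF sq]) auto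
    then show "(\<lambda>z. (g z)\<^sup>2) integrable_on ?S"
      by (simp add: absolutely_integrable_on_def)
    have "(\<lambda>z. 1::real) absolutely_integrable_on {a..b}" by simp
    then have "(\<lambda>z. 1::real) absolutely_integrable_on ?S"
      by (rule set_integrable_subset) auto
    then show "(\<lambda>z. 1::real) integrable_on ?S"
      by (simp add: absolutely_integrable_on_def)
  qed
  moreover have "norm (g z) \<le> 1 + (g z)\<^sup>2" for z
    using zero_le_power2[of "\<bar>g z\<bar> - 1/2"] by (simp add: power2_diff power2_eq_square algebra_simps)
  ultimately have "g absolutely_integrable_on ?S"
    using m by (intro measurable_bounded_by_integrable_imp_absolutely_integrable) auto
  then have "(\<lambda>z. if z \<in> ?S then g z else 0) absolutely_integrable_on UNIV"
    by (simp only: absolutely_integrable_restrict_UNIV)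
  also have "(\<lambda>z. if z \<in> ?S then g z else 0) = (\<lambda>z. if z \<in> {a..b} then ext0 g z else 0)"
    by (auto simp: ext0_def)
  finally show "ext0 g absolutely_integrable_on {a..b}"
    by (simp only: absolutely_integrable_restrict_UNIV)
qed

lemma integral_ext0: "(\<integral>z. ext0 g z * k z \<partial>neg_leb) = (\<integral>z. g z * k z \<partial>neg_leb)"
  by (rule Bochner_Integration.integral_cong) (auto simp: ext0_def)

section \<open>Representatives and the weak form of the equation\<close>

lemma fun_of_sq_int: "sq_int (fun_of u)" and abs_fun_of: "abs_L2neg (fun_of u) = u"
proof -
  have "\<exists>f. sq_int f \<and> abs_L2neg f = u"
    by (metis Quotient3_L2neg Quotient3_def sq_eq_def)
  then have "sq_int (fun_of u) \<and> abs_L2neg (fun_of u) = u"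
    unfolding fun_of_def by (rule someI_ex)
  then show "sq_int (fun_of u)" "abs_L2neg (fun_of u) = u" by auto
qed

lemma inner_fun_of: "inner u v = (\<integral>z. fun_of u z * fun_of v z \<partial>neg_leb)"
proof -
  have "inner (abs_L2neg f) (abs_L2neg g) = (\<integral>z. f z * g z \<partial>neg_leb)" if "sq_int f" "sq_int g" for f g
    using that by (simp add: inner_L2neg.abs_eq sq_eq_def)
  then show ?thesis
    using fun_of_sq_int abs_fun_of by metis
qed

text \<open>Moving every derivative to the test function gives the formal adjoint
  \<open>- (z \<phi>)'' + 3 \<phi>' - z\<^sup>2 \<phi>' / 4\<close>, and
  \<open>(z \<phi>)'' = z \<phi>'' + 2 \<phi>'\<close>.\<close>

lemma is_H_weak:
  assumes H: "is_H u f" and \<phi>: "test_fun \<phi>"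
  shows "(\<integral>z. fun_of u z * (- z * deriv (deriv \<phi>) z + (1 - z\<^sup>2 / 4) * deriv \<phi> z) \<partial>neg_leb)
    = (\<integral>z. fun_of f z * \<phi> z \<partial>neg_leb)"
proof -
  define U where "U = ext0 (fun_of u)"
  have U: "locint U" unfolding U_def by (intro locint_ext0 fun_of_sq_int)
  have d: "(\<phi> has_field_derivative deriv \<phi> z) (at z)"
    "(deriv \<phi> has_field_derivative deriv (deriv \<phi>) z) (at z)" for z
    by (auto intro: test_fun_has_deriv test_fun_deriv \<phi>)
  have 1: "deriv (\<lambda>z. z * \<phi> z) = (\<lambda>z. \<phi> z + z * deriv \<phi> z)"
    by (rule ext, rule DERIV_imp_deriv) (auto intro!: derivative_eq_intros d)
  have 2: "deriv (\<lambda>z. \<phi> z + z * deriv \<phi> z) = (\<lambda>z. 2 * deriv \<phi> z + z * deriv (deriv \<phi>) z)"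
    by (rule ext, rule DERIV_imp_deriv) (auto intro!: derivative_eq_intros d)
  have T: "distr_of u k = (\<integral>z. U z * k z \<partial>neg_leb)" for k
    by (simp add: distr_of_def U_def integral_ext0)
  let ?d = "deriv \<phi>" and ?dd = "deriv (deriv \<phi>)"
  have t: "test_fun ?d" "test_fun ?dd" by (auto intro: test_fun_deriv \<phi>)
  have i1: "integrable neg_leb (\<lambda>z. U z * ?d z)"
    by (rule locint_test_integrable[OF U t(1)])
  have i2: "integrable neg_leb (\<lambda>z. z * U z * ?dd z)"
    by (intro locint_test_integrable t locint_continuous_mult U continuous_intros)
  have i3: "integrable neg_leb (\<lambda>z. z\<^sup>2 * U z * ?d z)"
    by (intro locint_test_integrable t locint_continuous_mult U continuous_intros)
  have "distr_of f \<phi> = H_distr (distr_of u) \<phi>"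
    using H \<phi> by (simp add: is_H_def)
  also have "\<dots> = - (\<integral>z. U z * (2 * ?d z + z * ?dd z) \<partial>neg_leb) + 3 * (\<integral>z. U z * ?d z \<partial>neg_leb)
      - 1/4 * (\<integral>z. U z * (z\<^sup>2 * ?d z) \<partial>neg_leb)"
    by (simp add: H_distr_def mult_distr_def distr_deriv_def 1 2 T)
  also have "(\<integral>z. U z * (2 * ?d z + z * ?dd z) \<partial>neg_leb)
      = (\<integral>z. 2 * (U z * ?d z) + z * U z * ?dd z \<partial>neg_leb)"
    by (simp add: algebra_simps)
  also have "\<dots> = 2 * (\<integral>z. U z * ?d z \<partial>neg_leb) + (\<integral>z. z * U z * ?dd z \<partial>neg_leb)"
    using i1 i2 by simp
  also have "(\<integral>z. U z * (z\<^sup>2 * ?d z) \<partial>neg_leb) = (\<integral>z. z\<^sup>2 * U z * ?d z \<partial>neg_leb)"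
    by (simp add: algebra_simps)
  also have "- (2 * (\<integral>z. U z * ?d z \<partial>neg_leb) + (\<integral>z. z * U z * ?dd z \<partial>neg_leb))
      + 3 * (\<integral>z. U z * ?d z \<partial>neg_leb) - 1/4 * (\<integral>z. z\<^sup>2 * U z * ?d z \<partial>neg_leb)
      = (\<integral>z. U z * ?d z - z * U z * ?dd z - 1/4 * (z\<^sup>2 * U z * ?d z) \<partial>neg_leb)"
    using i1 i2 i3 by simp
  also have "\<dots> = (\<integral>z. U z * (- z * ?dd z + (1 - z\<^sup>2 / 4) * ?d z) \<partial>neg_leb)"
    by (rule Bochner_Integration.integral_cong) (auto simp: algebra_simps)
  also have "\<dots> = (\<integral>z. fun_of u z * (- z * ?dd z + (1 - z\<^sup>2 / 4) * ?d z) \<partial>neg_leb)"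
    by (simp add: U_def integral_ext0)
  finally show ?thesis by (simp add: distr_of_def)
qed

section \<open>From the weak to the classical equation\<close>

text \<open>Changing \<open>v\<close> on a null set does not change its primitive, so near
  \<open>z\<close> the fundamental theorem of calculus applies to the continuous \<open>g\<close>
  instead.\<close>

lemma indef_has_deriv:
  assumes v: "locint v" and N: "negligible {z. z < 0 \<and> v z \<noteq> g z}"
    and g: "continuous_on {..<0} g" and z: "z < 0"
  shows "(indef v has_field_derivative g z) (at z)"
proof -
  define a where "a = z - 1"
  define b where "b = z / 2"
  have ab: "a < z" "z < b" "b < 0" using z by (auto simp: a_def b_def)
  have eq: "indef v a + integral {a..t} g = indef v t" if "t \<in> {a..b}" for t
  proof -
    have "integral {a..t} g = integral {a..t} v"
      by (rule integral_spike[OF N]) (use that ab in auto)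
    then show ?thesis using indef_eq[OF v, of a t] that ab by simp
  qed
  have "((\<lambda>t. indef v a + integral {a..t} g) has_field_derivative 0 + g z) (at z within {a..b})"
    using ab by (intro DERIV_add DERIV_const integral_has_real_derivative continuous_on_subset[OF g]) auto
  then have "(indef v has_field_derivative 0 + g z) (at z within {a..b})"
    by (rule has_field_derivative_transform_within[where d = 1]) (use ab eq in auto)
  then show ?thesis
    using ab by (simp add: at_within_Icc_at)
qed

text \<open>The weak equation is integrated twice, each time at the cost of a constant. The last
  conclusion limits the singularity of \<open>W\<close> at 0 to order \<open>1 / z\<close>, which
  starts the analysis of the boundary term there.\<close>

lemma is_H_regularity:
  assumes H: "is_H u f"
  obtains W c l where
    "\<And>z. z < 0 \<Longrightarrow> (W has_field_derivative
        - (indef (ext0 (fun_of f)) z + c + 2 * W z - z\<^sup>2 * W z / 4) / z) (at z)"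
    "negligible {z. z < 0 \<and> fun_of u z \<noteq> W z}"
    "((\<lambda>z. z * W z) \<longlongrightarrow> l) (at_left 0)"
proof -
  define U where "U = ext0 (fun_of u)"
  define F where "F = ext0 (fun_of f)"
  have U: "locint U" unfolding U_def by (intro locint_ext0 fun_of_sq_int)
  have F: "locint F" unfolding F_def by (intro locint_ext0 fun_of_sq_int)
  \<comment> \<open>The weak equation reads \<open>\<integral> g \<phi>'' + (1 - z\<^sup>2 / 4) U
    \<phi>' = \<integral> F \<phi>\<close>. Writing the right side as
    \<open>- \<integral> indef F \<phi>'\<close> moves it into \<open>k\<close>, so that only
    \<open>\<phi>'\<close> and its derivative remain.\<close>
  define g where "g z = - z * U z" for z
  define k where "k z = (1 - z\<^sup>2 / 4) * U z + indef F z" for z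
  have g: "locint g" unfolding g_def by (intro locint_continuous_mult U continuous_intros)
  have k: "locint k" unfolding k_def
    by (intro locint_add locint_continuous_mult U locint_continuous continuous_on_indef F continuous_intros) simp
  define L where "L \<psi> = (\<integral>z. g z * deriv \<psi> z \<partial>neg_leb) + (\<integral>z. k z * \<psi> z \<partial>neg_leb)" for \<psi>
  have "L (\<lambda>z. \<phi> z + c * \<psi> z) = L \<phi> + c * L \<psi>" if t: "test_fun \<phi>" "test_fun \<psi>" for \<phi> \<psi> c
  proof -
    have "deriv (\<lambda>z. \<phi> z + c * \<psi> z) = (\<lambda>z. deriv \<phi> z + c * deriv \<psi> z)"
      by (rule ext, rule DERIV_imp_deriv) (intro DERIV_add DERIV_cmult test_fun_has_deriv t)
    then show ?thesis
      by (simp add: L_def integral_test_add_scale g k t test_fun_deriv) (simp add: algebra_simps)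
  qed
  moreover have "L (deriv \<phi>) = 0" if \<phi>: "test_fun \<phi>" for \<phi>
  proof -
    let ?d = "deriv \<phi>" and ?dd = "deriv (deriv \<phi>)"
    have t: "test_fun ?d" "test_fun ?dd" by (auto intro: test_fun_deriv \<phi>)
    have i: "integrable neg_leb (\<lambda>z. g z * ?dd z)" "integrable neg_leb (\<lambda>z. k z * ?d z)"
      "integrable neg_leb (\<lambda>z. indef F z * ?d z)"
      by (intro locint_test_integrable t g k locint_continuous continuous_on_indef F)+
    have "(\<integral>z. U z * (- z * ?dd z + (1 - z\<^sup>2 / 4) * ?d z) \<partial>neg_leb) = - (\<integral>z. indef F z * ?d z \<partial>neg_leb)"
      using is_H_weak[OF H \<phi>] indef_test[OF F \<phi>] by (simp add: U_def F_def integral_ext0)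
    also have "(\<integral>z. U z * (- z * ?dd z + (1 - z\<^sup>2 / 4) * ?d z) \<partial>neg_leb)
        = (\<integral>z. g z * ?dd z + k z * ?d z - indef F z * ?d z \<partial>neg_leb)"
      by (rule Bochner_Integration.integral_cong) (auto simp: g_def k_def algebra_simps)
    also have "\<dots> = L ?d - (\<integral>z. indef F z * ?d z \<partial>neg_leb)"
      using i by (simp add: L_def)
    finally show ?thesis by simp
  qed
  ultimately have "\<exists>c. \<forall>\<psi>. test_fun \<psi> \<longrightarrow> L \<psi> = c * (\<integral>z. \<psi> z \<partial>neg_leb)"
    by (rule annihilates_derivs_imp_multiple_of_integral[of L])
  then obtain c where c: "\<And>\<psi>. test_fun \<psi> \<Longrightarrow> L \<psi> = c * (\<integral>z. \<psi> z \<partial>neg_leb)"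
    by auto
  define h where "h z = k z - c" for z
  have const: "locint (\<lambda>z. c)" by (intro locint_continuous continuous_on_const)
  have h: "locint h" unfolding h_def by (intro locint_diff k const)
  \<comment> \<open>That \<open>L \<psi>\<close> is \<open>c\<close> times the integral of
    \<open>\<psi>\<close> means that \<open>g\<close> has the weak derivative
    \<open>h = k - c\<close>; hence \<open>g\<close> differs from the primitive of \<open>h\<close>
    by a constant almost everywhere.\<close>
  obtain d where d: "negligible {z. z < 0 \<and> g z - indef h z \<noteq> d}"
  proof (rule du_Bois_Reymond)
    show "locint (\<lambda>z. g z - indef h z)"
      by (intro locint_diff g locint_continuous continuous_on_indef h)
    fix \<psi> assume \<psi>: "test_fun \<psi>"
    have i: "integrable neg_leb (\<lambda>z. g z * deriv \<psi> z)" "integrable neg_leb (\<lambda>z. k z * \<psi> z)"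
      "integrable neg_leb (\<lambda>z. indef h z * deriv \<psi> z)" "integrable neg_leb (\<lambda>z. c * \<psi> z)"
      by (intro locint_test_integrable g k const test_fun_deriv \<psi> locint_continuous continuous_on_indef h)+
    have "(\<integral>z. (g z - indef h z) * deriv \<psi> z \<partial>neg_leb)
        = (\<integral>z. g z * deriv \<psi> z \<partial>neg_leb) - (\<integral>z. indef h z * deriv \<psi> z \<partial>neg_leb)"
      using i by (simp add: left_diff_distrib)
    also have "\<dots> = (\<integral>z. g z * deriv \<psi> z \<partial>neg_leb) + (\<integral>z. k z * \<psi> z - c * \<psi> z \<partial>neg_leb)"
      using indef_test[OF h \<psi>] by (simp add: h_def left_diff_distrib)
    also have "\<dots> = 0"
      using c[OF \<psi>] i by (simp add: L_def)
    finally show "(\<integral>z. (g z - indef h z) * deriv \<psi> z \<partial>neg_leb) = 0" .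
  qed
  \<comment> \<open>Solves \<open>- z * U z = indef h z + d\<close> for \<open>U\<close>. As
    \<open>indef h\<close> is continuous, this is a continuous representative.\<close>
  define W where "W z = - ((indef h z + d) / z)" for z
  have UW: "negligible {z. z < 0 \<and> fun_of u z \<noteq> W z}"
    by (rule negligible_subset[OF d]) (auto simp: U_def W_def g_def ext0_def field_simps)
  have Wc: "continuous_on {..<0} W"
    unfolding W_def by (intro continuous_intros continuous_on_subset[OF continuous_on_indef[OF h]]) auto
  let ?G = "\<lambda>z. indef F z - c"
  \<comment> \<open>Replacing \<open>U\<close> by \<open>W\<close> in \<open>h\<close> changes it
    only on a null set and makes it continuous, so its primitive, and with it \<open>W\<close>, is
    differentiable.\<close>
  have dh: "(indef h has_field_derivative (1 - z\<^sup>2 / 4) * W z + ?G z) (at z)" if "z < 0" for z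
  proof (rule indef_has_deriv[OF h _ _ that])
    show "negligible {z. z < 0 \<and> h z \<noteq> (1 - z\<^sup>2 / 4) * W z + ?G z}"
      by (rule negligible_subset[OF UW]) (auto simp: h_def k_def U_def ext0_def)
    show "continuous_on {..<0} (\<lambda>z. (1 - z\<^sup>2 / 4) * W z + ?G z)"
      by (intro continuous_intros Wc continuous_on_subset[OF continuous_on_indef[OF F]]) auto
  qed
  have "(W has_field_derivative - (indef F z + - c + 2 * W z - z\<^sup>2 * W z / 4) / z) (at z)"
    if z: "z < 0" for z
  proof -
    have "((\<lambda>z. indef h z + d) has_field_derivative (1 - z\<^sup>2 / 4) * W z + ?G z) (at z)"
      using DERIV_add[OF dh[OF z] DERIV_const[of d]] by simp
    then have "((\<lambda>z. - ((indef h z + d) / z)) has_field_derivative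
        - ((((1 - z\<^sup>2 / 4) * W z + ?G z) * z - (indef h z + d) * 1) / (z * z))) (at z)"
      by (rule DERIV_minus[OF DERIV_divide[OF _ DERIV_ident]]) (use z in auto)
    moreover have "(\<lambda>z. - ((indef h z + d) / z)) = W" by (simp add: W_def[abs_def])
    moreover have "indef h z + d = - z * W z" using z by (simp add: W_def)
    then have "- ((((1 - z\<^sup>2 / 4) * W z + ?G z) * z - (indef h z + d) * 1) / (z * z))
        = - (indef F z + - c + 2 * W z - z\<^sup>2 * W z / 4) / z"
      using z by (simp only:) (simp add: field_simps power2_eq_square)
    ultimately show ?thesis by (simp only:)
  qed
  moreover have "((\<lambda>z. z * W z) \<longlongrightarrow> - (indef h 0 + d)) (at_left 0)"
  proof (rule Lim_transform_eventually)
    have "isCont (indef h) 0"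
      using continuous_on_indef[OF h] by (simp add: continuous_on_eq_continuous_at)
    then have "(indef h \<longlongrightarrow> indef h 0) (at_left 0)"
      by (meson continuous_at_imp_continuous_at_within continuous_within)
    then show "((\<lambda>z. - (indef h z + d)) \<longlongrightarrow> - (indef h 0 + d)) (at_left 0)"
      by (intro tendsto_intros)
    show "\<forall>\<^sub>F z in at_left 0. - (indef h z + d) = z * W z"
      by (auto simp: eventually_at_left_field W_def intro: exI[of _ "-1"])
  qed
  ultimately show thesis
    using UW that[of W "- c"] by (simp add: F_def)
qed

section \<open>The energy identity and its boundary terms\<close>

text \<open>If the bound failed at \<open>z\<close>, then \<open>t\<^sup>2 exp (- t\<^sup>2 / 8) W t\<close> would stay away from \<open>0\<close> for
  \<open>t \<le> z\<close>, since its derivative \<open>- t exp (- t\<^sup>2 / 8) G t\<close> is dominated by that of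
  \<open>- 8 \<epsilon> t exp (- t\<^sup>2 / 8)\<close>; but then \<open>W\<close> grows like \<open>exp (t\<^sup>2 / 8) / t\<^sup>2\<close>.\<close>

lemma ode_solution_decay_upper:
  fixes W G :: "real \<Rightarrow> real"
  assumes W: "\<And>z. z < 0 \<Longrightarrow> (W has_field_derivative - (G z + 2 * W z - z\<^sup>2 * W z / 4) / z) (at z)"
    and G: "\<And>z. z \<le> z0 \<Longrightarrow> \<bar>G z\<bar> \<le> \<epsilon> * \<bar>z\<bar>" and \<epsilon>: "\<epsilon> > 0"
    and C: "\<And>a b. a < b \<Longrightarrow> b < 0 \<Longrightarrow> integral {a..b} (\<lambda>z. (W z)\<^sup>2) \<le> C"
    and z: "z \<le> z0" "z \<le> -3"
  shows "- z * W z \<le> 8 * \<epsilon>"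
proof (rule ccontr)
  assume "\<not> - z * W z \<le> 8 * \<epsilon>"
  then have big: "8 * \<epsilon> + z * W z < 0" by simp
  define D where "D t = exp (- t\<^sup>2 / 8) * (- 8 * \<epsilon> * t - t\<^sup>2 * W t)" for t
  have D': "(D has_field_derivative exp (- t\<^sup>2 / 8) * (8 * \<epsilon> * (t\<^sup>2 / 4 - 1) + t * G t)) (at t)"
    if "t < 0" for t
    unfolding D_def
    by (rule derivative_eq_intros W refl that | simp)+
      (use that in \<open>simp add: field_simps power2_eq_square\<close>)
  have D'_nonneg: "0 \<le> exp (- t\<^sup>2 / 8) * (8 * \<epsilon> * (t\<^sup>2 / 4 - 1) + t * G t)" if t: "t \<le> z" for t
  proof -
    \<comment> \<open>The threshold \<open>-3\<close> ensures \<open>t\<^sup>2 \<ge> 8\<close>, so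
      that \<open>8 * \<epsilon> * (t\<^sup>2 / 4 - 1)\<close> is at least
      \<open>\<epsilon> * t\<^sup>2\<close>, the bound for
      \<open>\<bar>t * G t\<bar>\<close>.\<close>
    have "9 \<le> t\<^sup>2" using power_mono[of 3 "- t" 2] t z by simp
    then have "\<epsilon> * 8 \<le> \<epsilon> * t\<^sup>2" using \<epsilon> by (intro mult_left_mono) auto
    moreover have "\<bar>t * G t\<bar> \<le> \<bar>t\<bar> * (\<epsilon> * \<bar>t\<bar>)"
      unfolding abs_mult using t z by (intro mult_left_mono G) auto
    then have "\<bar>t * G t\<bar> \<le> \<epsilon> * t\<^sup>2" by (simp add: power2_eq_square mult_ac)
    ultimately have "0 \<le> 8 * \<epsilon> * (t\<^sup>2 / 4 - 1) + t * G t" by (simp add: algebra_simps)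
    then show ?thesis by simp
  qed
  have mono: "D y \<le> D z" if "y \<le> z" for y
    using that D' D'_nonneg z
    by (intro DERIV_nonneg_imp_nondecreasing[of y z D]) (force intro!: exI)+
  define \<delta> where "\<delta> = - D z"
  have "D z = exp (- z\<^sup>2 / 8) * (- z) * (8 * \<epsilon> + z * W z)"
    by (simp add: D_def power2_eq_square algebra_simps)
  then have \<delta>: "\<delta> > 0"
    using big z mult_neg_neg[of "exp (- z\<^sup>2 / 8) * z" "8 * \<epsilon> + z * W z"]
    by (simp add: \<delta>_def mult_pos_neg)
  \<comment> \<open>Monotonicity of \<open>D\<close> gives
    \<open>\<delta> * exp (y\<^sup>2 / 8) \<le> y\<^sup>2 * W y\<close>. The crude bound
    \<open>exp (y\<^sup>2 / 8) \<ge> y\<^sup>2 / 8\<close> already keeps \<open>W\<close> above a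
    positive constant.\<close>
  have Wy: "\<delta> / 8 \<le> W y" if y: "y \<le> z" for y
  proof -
    let ?e = "exp (y\<^sup>2 / 8)"
    have "y < 0" using y z by simp
    have "\<delta> \<le> exp (- y\<^sup>2 / 8) * (8 * \<epsilon> * y + y\<^sup>2 * W y)"
      using mono[OF y] by (simp add: \<delta>_def D_def algebra_simps)
    also have "\<dots> \<le> exp (- y\<^sup>2 / 8) * (y\<^sup>2 * W y)"
      using \<epsilon> \<open>y < 0\<close> by (intro mult_left_mono) (auto simp: mult_le_0_iff)
    finally have 1: "\<delta> * ?e \<le> y\<^sup>2 * W y"
      by (simp add: exp_minus field_simps)
    have "y\<^sup>2 / 8 \<le> ?e" using exp_ge_add_one_self[of "y\<^sup>2 / 8"] by linarith
    then have "\<delta> * (y\<^sup>2 / 8) \<le> \<delta> * ?e" using \<delta> by (intro mult_left_mono) auto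
    with 1 have "y\<^sup>2 * (\<delta> / 8) \<le> y\<^sup>2 * W y" by (simp add: mult.commute)
    then show ?thesis using \<open>y < 0\<close> by (simp add: mult_le_cancel_left)
  qed
  let ?k = "(\<delta> / 8)\<^sup>2"
  have k: "?k > 0" using \<delta> by simp
  \<comment> \<open>An interval so long that the lower bound for the integral of
    \<open>W\<^sup>2\<close> becomes \<open>\<bar>C\<bar> + 1\<close>.\<close>
  define a where "a = z - (\<bar>C\<bar> + 1) / ?k"
  have a: "a < z" using k by (simp add: a_def divide_pos_pos)
  have Wc: "continuous_on {a..z} W"
    using W z by (intro continuous_at_imp_continuous_on) (force intro: DERIV_isCont)
  have "(z - a) * ?k = integral {a..z} (\<lambda>_. ?k)" using a by simp
  also have "\<dots> \<le> integral {a..z} (\<lambda>y. (W y)\<^sup>2)"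
    using Wy \<delta> by (intro integral_le integrable_continuous_real continuous_intros Wc power_mono) auto
  also have "\<dots> \<le> C" using C a z by simp
  finally have "(z - a) * ?k \<le> C" .
  moreover have "(z - a) * ?k = \<bar>C\<bar> + 1" using k by (simp add: a_def)
  ultimately show False by simp
qed

text \<open>Integrating Young's inequality \<open>\<bar>F\<bar> \<le> \<epsilon> / 2 + F\<^sup>2 /
  (2 * \<epsilon>)\<close> bounds the primitive by \<open>\<epsilon> * \<bar>z\<bar> / 2\<close>
  plus a constant. Far to the left, the other half of \<open>\<epsilon> * \<bar>z\<bar>\<close>
  absorbs this constant and \<open>c\<close>.\<close>

lemma indef_sublinear:
  assumes F: "locint F" and F2: "\<And>a b. (\<lambda>z. (F z)\<^sup>2) integrable_on {a..b}"
    and C: "\<And>a b. integral {a..b} (\<lambda>z. (F z)\<^sup>2) \<le> C" and \<epsilon>: "\<epsilon> > 0"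
  obtains z0 where "z0 < 0" "\<And>z. z \<le> z0 \<Longrightarrow> \<bar>indef F z + c\<bar> \<le> \<epsilon> * \<bar>z\<bar>"
proof -
  let ?d = "\<epsilon> / 2"
  define k where "k = 1 / (2 * \<epsilon>)"
  have bd: "\<bar>indef F z\<bar> \<le> ?d * \<bar>z\<bar> + C / (2 * \<epsilon>)" if "z < 0" for z
  proof -
    have "\<bar>indef F z\<bar> = norm (integral {z..0} F)" by (simp add: indef_def)
    also have "\<dots> \<le> integral {z..0} (\<lambda>t. ?d + (F t)\<^sup>2 * k)"
    proof (rule integral_norm_bound_integral)
      show "F integrable_on {z..0}" by (rule locint_integrable_on[OF F])
      show "(\<lambda>t. ?d + (F t)\<^sup>2 * k) integrable_on {z..0}"
        by (intro integrable_add integrable_on_mult_left F2 integrable_const_ivl)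
      fix t
      have "0 \<le> (\<epsilon> - \<bar>F t\<bar>)\<^sup>2" by simp
      then show "norm (F t) \<le> ?d + (F t)\<^sup>2 * k"
        using \<epsilon> by (simp add: k_def power2_diff field_simps power2_eq_square)
    qed
    also have "\<dots> = ?d * \<bar>z\<bar> + integral {z..0} (\<lambda>t. (F t)\<^sup>2) * k"
      using that F2 by (subst integral_add) (auto intro!: integrable_on_mult_left)
    also have "\<dots> \<le> ?d * \<bar>z\<bar> + C * k"
      using C \<epsilon> by (intro add_left_mono mult_right_mono) (auto simp: k_def)
    finally show ?thesis by (simp add: k_def)
  qed
  let ?B = "\<bar>C\<bar> / (2 * \<epsilon>) + \<bar>c\<bar>"
  define z0 where "z0 = - (?B / ?d) - 1"
  have B: "?B \<ge> 0" using \<epsilon> by simp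
  then have "?B / ?d \<ge> 0" using \<epsilon> by (intro divide_nonneg_pos) auto
  then have "z0 < 0" by (simp add: z0_def)
  moreover have "\<bar>indef F z + c\<bar> \<le> \<epsilon> * \<bar>z\<bar>" if "z \<le> z0" for z
  proof -
    have z: "z < 0" using that \<open>z0 < 0\<close> by simp
    have "?B / ?d \<le> \<bar>z\<bar>" using that z by (simp add: z0_def)
    then have "?B \<le> ?d * \<bar>z\<bar>" using \<epsilon> by (simp add: pos_divide_le_eq mult.commute)
    moreover have "C / (2 * \<epsilon>) \<le> \<bar>C\<bar> / (2 * \<epsilon>)" using \<epsilon> by (intro divide_right_mono) auto
    moreover have "?d * \<bar>z\<bar> + ?d * \<bar>z\<bar> = \<epsilon> * \<bar>z\<bar>" by simp
    ultimately show ?thesis using bd[OF z] abs_triangle_ineq[of "indef F z" c] by linarith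
  qed
  ultimately show thesis by (rule that)
qed

text \<open>The product \<open>G z * W z\<close> is the boundary term of the integration by parts;
  the bracket is a primitive of what remains once the integrand is completed to a square.\<close>

definition energy :: "(real \<Rightarrow> real) \<Rightarrow> (real \<Rightarrow> real) \<Rightarrow> real \<Rightarrow> real"
  where "energy G W z = G z * W z + ((W z)\<^sup>2 - z\<^sup>2 * (W z)\<^sup>2 / 8 + z * (W z)\<^sup>2 / 2)"

text \<open>The one-sided decay estimate, applied to \<open>W\<close> and to \<open>- W\<close>,
  gives \<open>z * W z \<rightarrow> 0\<close>. Every term of the energy is a product of powers of
  \<open>z * W z\<close>, \<open>G z / z\<close> and \<open>1 / z\<close> with a factor tending to
  0.\<close>

lemma energy_at_bot:
  assumes W: "\<And>z. z < 0 \<Longrightarrow> (W has_field_derivative - (G z + 2 * W z - z\<^sup>2 * W z / 4) / z) (at z)"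
    and G: "\<And>\<epsilon>. \<epsilon> > 0 \<Longrightarrow> \<exists>z0<0. \<forall>z\<le>z0. \<bar>G z\<bar> \<le> \<epsilon> * \<bar>z\<bar>"
    and C: "\<And>a b. a < b \<Longrightarrow> b < 0 \<Longrightarrow> integral {a..b} (\<lambda>z. (W z)\<^sup>2) \<le> C"
  shows "(energy G W \<longlongrightarrow> 0) at_bot"
proof -
  have zW: "((\<lambda>z. z * W z) \<longlongrightarrow> 0) at_bot"
  proof (rule tendstoI)
    fix e :: real assume "e > 0"
    let ?\<epsilon> = "e / 16"
    have \<epsilon>: "?\<epsilon> > 0" using \<open>e > 0\<close> by simp
    obtain z0 where z0: "\<And>z. z \<le> z0 \<Longrightarrow> \<bar>G z\<bar> \<le> ?\<epsilon> * \<bar>z\<bar>" using G[OF \<epsilon>] by blast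
    have "dist (z * W z) 0 < e" if z: "z \<le> min z0 (-3)" for z
    proof -
      have "- z * W z \<le> 8 * ?\<epsilon>"
        using z by (intro ode_solution_decay_upper[OF W z0 \<epsilon> C]) auto
      \<comment> \<open>The equation is linear, so \<open>- W\<close> solves it with
        \<open>- G\<close> in place of \<open>G\<close>.\<close>
      moreover have "- z * - W z \<le> 8 * ?\<epsilon>"
      proof (rule ode_solution_decay_upper[where W = "\<lambda>z. - W z" and G = "\<lambda>z. - G z"])
        fix z :: real assume "z < 0"
        then show "((\<lambda>z. - W z) has_field_derivative
            - (- G z + 2 * - W z - z\<^sup>2 * - W z / 4) / z) (at z)"
          by (rule DERIV_cong[OF DERIV_minus[OF W]]) (use \<open>z < 0\<close> in \<open>simp add: field_simps\<close>)
      qed (use z z0 \<epsilon> C in auto)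
      ultimately show ?thesis using \<open>e > 0\<close> by (auto simp: dist_real_def)
    qed
    then show "\<forall>\<^sub>F z in at_bot. dist (z * W z) 0 < e"
      unfolding eventually_at_bot_linorder by blast
  qed
  have Gz: "((\<lambda>z. G z / z) \<longlongrightarrow> 0) at_bot"
  proof (rule tendstoI)
    fix e :: real assume "e > 0"
    then have "e / 2 > 0" by simp
    then obtain z0 where z0: "z0 < 0" "\<And>z. z \<le> z0 \<Longrightarrow> \<bar>G z\<bar> \<le> e / 2 * \<bar>z\<bar>"
      using G by blast
    have "dist (G z / z) 0 < e" if z: "z \<le> z0" for z
    proof -
      have "\<bar>G z\<bar> / \<bar>z\<bar> \<le> e / 2"
        using z0(1) z by (intro mult_imp_div_pos_le z0(2)) auto
      then have "\<bar>G z\<bar> / \<bar>z\<bar> < e" using \<open>e > 0\<close> by linarith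
      then show ?thesis by (simp add: abs_divide)
    qed
    then show "\<forall>\<^sub>F z in at_bot. dist (G z / z) 0 < e"
      unfolding eventually_at_bot_linorder by blast
  qed
  have iz: "((\<lambda>z::real. inverse z) \<longlongrightarrow> 0) at_bot"
    by (rule tendsto_mono[OF at_bot_le_at_infinity tendsto_inverse_0])
  have "((\<lambda>z. G z / z * (z * W z) + ((z * W z)\<^sup>2 * (inverse z)\<^sup>2 - (z * W z)\<^sup>2 / 8
      + (z * W z)\<^sup>2 * inverse z / 2)) \<longlongrightarrow> 0 * 0 + (0\<^sup>2 * 0\<^sup>2 - 0\<^sup>2 / 8 + 0\<^sup>2 * 0 / 2)) at_bot"
    by (intro tendsto_intros zW Gz iz) auto
  then have "((\<lambda>z. G z / z * (z * W z) + ((z * W z)\<^sup>2 * (inverse z)\<^sup>2 - (z * W z)\<^sup>2 / 8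
      + (z * W z)\<^sup>2 * inverse z / 2)) \<longlongrightarrow> 0) at_bot" by simp
  then show ?thesis
  proof (rule Lim_transform_eventually)
    show "\<forall>\<^sub>F z in at_bot. G z / z * (z * W z) + ((z * W z)\<^sup>2 * (inverse z)\<^sup>2 - (z * W z)\<^sup>2 / 8
      + (z * W z)\<^sup>2 * inverse z / 2) = energy G W z"
      using eventually_le_at_bot[of "-1::real"]
      by eventually_elim (simp add: energy_def field_simps power2_eq_square)
  qed
qed

text \<open>L'Hopital's rule applied to \<open>z\<^sup>2 * exp (- z\<^sup>2 / 8) * W z\<close> over
  \<open>z\<^sup>2\<close> gives \<open>W \<rightarrow> - c / 2\<close>: the numerator has
  derivative \<open>- z * exp (- z\<^sup>2 / 8) * G z\<close>, so the quotient of derivatives tends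
  to \<open>- c / 2\<close>.\<close>

lemma energy_at_left_0:
  assumes W: "\<And>z. z < 0 \<Longrightarrow> (W has_field_derivative - (G z + 2 * W z - z\<^sup>2 * W z / 4) / z) (at z)"
    and G: "(G \<longlongrightarrow> c) (at_left 0)"
    and zW: "((\<lambda>z. z * W z) \<longlongrightarrow> l) (at_left 0)"
  shows "(energy G W \<longlongrightarrow> - c\<^sup>2 / 4) (at_left 0)"
proof -
  define e where "e z = exp (- z\<^sup>2 / 8)" for z :: real
  have id0: "((\<lambda>z::real. z) \<longlongrightarrow> 0) (at_left 0)" by (rule tendsto_ident_at)
  have e1: "(e \<longlongrightarrow> exp (- 0\<^sup>2 / 8)) (at_left 0)"
    unfolding e_def by (intro tendsto_intros) auto
  have neg: "\<forall>\<^sub>F z::real in at_left 0. z < 0"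
    by (auto simp: eventually_at_left_field intro: exI[of _ "-1"])
  have "((\<lambda>z. (z * (z * W z) * e z) / z\<^sup>2) \<longlongrightarrow> - (1 * c) / 2) (at_left 0)"
  proof (rule lhopital_left[where f' = "\<lambda>z. - z * e z * G z" and g' = "\<lambda>z. 2 * z"])
    \<comment> \<open>Grouping the numerator around \<open>z * W z\<close>, whose limit exists,
      shows that it tends to 0 before \<open>W\<close> itself is known to be bounded.\<close>
    have "((\<lambda>z. z * (z * W z) * e z) \<longlongrightarrow> 0 * l * exp (- 0\<^sup>2 / 8)) (at_left 0)"
      by (intro tendsto_mult id0 zW e1)
    then show "((\<lambda>z. z * (z * W z) * e z) \<longlongrightarrow> 0) (at_left 0)" by simp
    have "((\<lambda>z::real. z\<^sup>2) \<longlongrightarrow> 0\<^sup>2) (at_left 0)" by (intro tendsto_intros)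
    then show "((\<lambda>z::real. z\<^sup>2) \<longlongrightarrow> 0) (at_left 0)" by simp
    show "\<forall>\<^sub>F z::real in at_left 0. z\<^sup>2 \<noteq> 0" "\<forall>\<^sub>F z::real in at_left 0. 2 * z \<noteq> 0"
      using neg by (eventually_elim, simp)+
    show "\<forall>\<^sub>F z in at_left 0. ((\<lambda>z. z * (z * W z) * e z) has_field_derivative - z * e z * G z) (at z)"
      using neg
    proof eventually_elim
      case (elim z)
      show ?case
        unfolding e_def
        by (rule derivative_eq_intros W refl elim | simp)+
          (use elim in \<open>simp add: field_simps power2_eq_square\<close>)
    qed
    show "\<forall>\<^sub>F z::real in at_left 0. ((\<lambda>z. z\<^sup>2) has_field_derivative 2 * z) (at z)"
      by (intro always_eventually allI) (auto intro!: derivative_eq_intros)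
    have "((\<lambda>z. - (e z * G z) / 2) \<longlongrightarrow> - (exp (- 0\<^sup>2 / 8) * c) / 2) (at_left 0)"
      by (intro tendsto_intros e1 G) auto
    then have "((\<lambda>z. - (e z * G z) / 2) \<longlongrightarrow> - (1 * c) / 2) (at_left 0)" by simp
    then show "((\<lambda>z. (- z * e z * G z) / (2 * z)) \<longlongrightarrow> - (1 * c) / 2) (at_left 0)"
      by (rule Lim_transform_eventually) (use neg in eventually_elim, simp add: field_simps)
  qed
  then have "((\<lambda>z. (z * (z * W z) * e z) / z\<^sup>2 / e z) \<longlongrightarrow> - (1 * c) / 2 / exp (- 0\<^sup>2 / 8)) (at_left 0)"
    by (rule tendsto_divide[OF _ e1]) simp
  then have "((\<lambda>z. (z * (z * W z) * e z) / z\<^sup>2 / e z) \<longlongrightarrow> - c / 2) (at_left 0)" by simp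
  then have W0: "(W \<longlongrightarrow> - c / 2) (at_left 0)"
    by (rule Lim_transform_eventually)
      (use neg in eventually_elim, simp add: e_def field_simps power2_eq_square)
  have "(energy G W \<longlongrightarrow> c * (- c / 2) + ((- c / 2)\<^sup>2 - 0\<^sup>2 * (- c / 2)\<^sup>2 / 8 + 0 * (- c / 2)\<^sup>2 / 2)) (at_left 0)"
    unfolding energy_def[abs_def] by (intro tendsto_intros G W0 id0) auto
  then show ?thesis by (simp add: power2_eq_square field_simps)
qed

text \<open>After integration by parts the equation eliminates \<open>G\<close>. The rest is an
  exact derivative plus \<open>z * (W' - W / 2)\<^sup>2\<close>, which is nonpositive because
  \<open>z < 0\<close>.\<close>

lemma energy_estimate:
  assumes W: "\<And>z. z < 0 \<Longrightarrow> (W has_field_derivative - (G z + 2 * W z - z\<^sup>2 * W z / 4) / z) (at z)"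
    and F: "locint F" and G: "\<And>z. G z = indef F z + c" and ab: "a < b" "b < 0"
  shows "integral {a..b} (\<lambda>z. F z * W z + (W z)\<^sup>2 / 2) \<le> energy G W b - energy G W a"
proof -
  define W' where "W' z = - (G z + 2 * W z - z\<^sup>2 * W z / 4) / z" for z
  define R where "R z = (W z)\<^sup>2 - z\<^sup>2 * (W z)\<^sup>2 / 8 + z * (W z)\<^sup>2 / 2" for z
  define R' where "R' z = 2 * W z * W' z - (2 * z * (W z)\<^sup>2 + z\<^sup>2 * (2 * W z * W' z)) / 8
      + ((W z)\<^sup>2 + z * (2 * W z * W' z)) / 2" for z
  have dW: "(W has_field_derivative W' z) (at z)" if "z < 0" for z
    using W[OF that] by (simp add: W'_def)
  have dR: "(R has_field_derivative R' z) (at z)" if "z < 0" for z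
    unfolding R_def R'_def
    by (rule derivative_eq_intros dW refl that | simp)+ (simp add: field_simps)
  have Wc: "continuous_on {a..b} W"
    using ab by (intro continuous_at_imp_continuous_on ballI DERIV_isCont[OF dW]) auto
  have Gc: "continuous_on {a..b} G"
    unfolding G by (intro continuous_intros continuous_on_subset[OF continuous_on_indef[OF F]]) auto
  have W'c: "continuous_on {a..b} W'"
    unfolding W'_def using ab by (intro continuous_intros Wc Gc) auto
  have FW: "(\<lambda>z. F z * W z) integrable_on {a..b}"
    using absolutely_integrable_continuous_mult[OF Wc locint_on[OF F]]
    by (simp add: absolutely_integrable_on_def mult.commute)
  have parts: "integral {a..b} (\<lambda>z. F z * W z) = G b * W b - G a * W a - integral {a..b} (\<lambda>z. G z * W' z)"
  proof (rule integral_by_parts_indefinite[OF locint_on[OF F] _ _ _ W'c])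
    show "G t = G a + integral {a..t} F" if "t \<in> {a..b}" for t
      using indef_eq[OF F, of a t] that ab unfolding G by simp
    show "(W has_field_derivative W' t) (at t within {a..b})" if "t \<in> {a..b}" for t
      by (rule has_field_derivative_at_within[OF dW]) (use that ab in auto)
  qed (use ab in simp)
  have "(R' has_integral R b - R a) {a..b}"
    using ab by (intro fundamental_theorem_of_calculus)
      (auto simp flip: has_real_derivative_iff_has_vector_derivative
        intro!: has_field_derivative_at_within[OF dR])
  then have R: "integral {a..b} R' = R b - R a" and R'i: "R' integrable_on {a..b}"
    by (auto simp: has_integral_iff)
  have GW': "(\<lambda>z. G z * W' z) integrable_on {a..b}" and W2: "(\<lambda>z. (W z)\<^sup>2 / 2) integrable_on {a..b}"
    by (intro integrable_continuous_real continuous_intros Gc W'c Wc; simp)+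
  have "integral {a..b} (\<lambda>z. (W z)\<^sup>2 / 2 - G z * W' z) \<le> integral {a..b} R'"
  proof (rule integral_le[OF integrable_diff[OF W2 GW'] R'i])
    fix z assume "z \<in> {a..b}"
    then have z: "z < 0" using ab by auto
    have Gz: "G z = - z * W' z - 2 * W z + z\<^sup>2 * W z / 4"
      using z by (simp add: W'_def field_simps)
    have "(W z)\<^sup>2 / 2 - G z * W' z = R' z + z * (W' z - W z / 2)\<^sup>2"
      by (simp add: Gz R'_def power2_eq_square field_simps)
    moreover have "z * (W' z - W z / 2)\<^sup>2 \<le> 0" using z by (simp add: mult_nonpos_nonneg)
    ultimately show "(W z)\<^sup>2 / 2 - G z * W' z \<le> R' z" by simp
  qed
  then have "integral {a..b} (\<lambda>z. (W z)\<^sup>2 / 2) - integral {a..b} (\<lambda>z. G z * W' z) \<le> R b - R a"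
    by (simp add: integral_diff[OF W2 GW'] R)
  moreover have "integral {a..b} (\<lambda>z. F z * W z + (W z)\<^sup>2 / 2)
      = integral {a..b} (\<lambda>z. F z * W z) + integral {a..b} (\<lambda>z. (W z)\<^sup>2 / 2)"
    by (rule integral_add[OF FW W2])
  ultimately show ?thesis
    using parts by (simp add: energy_def R_def)
qed

section \<open>Dissipativity and decay\<close>

lemma sq_int_ext0_integral:
  assumes g: "sq_int g"
  shows "(\<lambda>z. (ext0 g z)\<^sup>2) integrable_on {a..b}"
    and "integral {a..b} (\<lambda>z. (ext0 g z)\<^sup>2) \<le> (\<integral>z. (g z)\<^sup>2 \<partial>neg_leb)"
proof -
  have "integrable lebesgue (\<lambda>z. indicator {..<0} z *\<^sub>R (g z)\<^sup>2)"
    using g by (simp add: sq_int_def integrable_restrict_space)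
  moreover have eq: "(\<lambda>z. indicator {..<0} z *\<^sub>R (g z)\<^sup>2) = (\<lambda>z. (ext0 g z)\<^sup>2)"
    by (auto simp: ext0_def)
  ultimately have i: "integrable lebesgue (\<lambda>z. (ext0 g z)\<^sup>2)" by (simp only:)
  then have ab: "(\<lambda>z. (ext0 g z)\<^sup>2) absolutely_integrable_on {a..b}"
    unfolding set_integrable_def by (intro integrable_mult_indicator) auto
  then show "(\<lambda>z. (ext0 g z)\<^sup>2) integrable_on {a..b}"
    by (simp add: absolutely_integrable_on_def)
  have "integral {a..b} (\<lambda>z. (ext0 g z)\<^sup>2) \<le> integral UNIV (\<lambda>z. (ext0 g z)\<^sup>2)"
    using ab integrable_on_lebesgue[OF i]
    by (intro integral_subset_le) (auto simp: absolutely_integrable_on_def)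
  also have "\<dots> = integral\<^sup>L lebesgue (\<lambda>z. (ext0 g z)\<^sup>2)"
    by (simp add: integral_lebesgue[OF i])
  also have "\<dots> = (\<integral>z. (g z)\<^sup>2 \<partial>neg_leb)"
    unfolding eq[symmetric] by (simp add: integral_restrict_space)
  finally show "integral {a..b} (\<lambda>z. (ext0 g z)\<^sup>2) \<le> (\<integral>z. (g z)\<^sup>2 \<partial>neg_leb)" .
qed

text \<open>The energy estimate is taken to the limit along intervals that exhaust the half-line.
  The boundary terms contribute 0 at minus infinity and \<open>- c\<^sup>2 / 4 \<le> 0\<close> at
  the origin.\<close>

lemma is_H_dissipative:
  assumes H: "is_H u f"
  shows "inner u f \<le> - (norm u)\<^sup>2 / 2"
proof -
  define U where "U = ext0 (fun_of u)"
  define F where "F = ext0 (fun_of f)"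
  have U: "locint U" and F: "locint F"
    unfolding U_def F_def by (intro locint_ext0 fun_of_sq_int)+
  obtain W c l where W: "\<And>z. z < 0 \<Longrightarrow> (W has_field_derivative
        - (indef F z + c + 2 * W z - z\<^sup>2 * W z / 4) / z) (at z)"
    and UW: "negligible {z. z < 0 \<and> fun_of u z \<noteq> W z}"
    and zW: "((\<lambda>z. z * W z) \<longlongrightarrow> l) (at_left 0)"
    using is_H_regularity[OF H] unfolding F_def by blast
  define G where "G z = indef F z + c" for z
  have W': "(W has_field_derivative - (G z + 2 * W z - z\<^sup>2 * W z / 4) / z) (at z)" if "z < 0" for z
    using W[OF that] by (simp add: G_def)
  \<comment> \<open>Carries integrals of the representative \<open>U\<close> over to the
    differentiable \<open>W\<close>; the cases needed are the square and the integrand of the energy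
    estimate.\<close>
  have eqW: "integral {a..b} (\<lambda>z. k z (U z)) = integral {a..b} (\<lambda>z. k z (W z))" if "b < 0"
    for a b and k :: "real \<Rightarrow> real \<Rightarrow> real"
    by (rule integral_spike[OF UW]) (use that in \<open>auto simp: U_def ext0_def\<close>)
  have "isCont (indef F) 0"
    using continuous_on_indef[OF F] by (simp add: continuous_on_eq_continuous_at)
  then have "(indef F \<longlongrightarrow> indef F 0) (at_left 0)"
    by (meson continuous_at_imp_continuous_at_within continuous_within)
  then have "(G \<longlongrightarrow> indef F 0 + c) (at_left 0)"
    unfolding G_def by (intro tendsto_intros)
  then have "(G \<longlongrightarrow> c) (at_left 0)" by (simp add: indef_def)
  then have right: "(energy G W \<longlongrightarrow> - c\<^sup>2 / 4) (at_left 0)"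
    by - (rule energy_at_left_0[OF W' _ zW])
  have left: "(energy G W \<longlongrightarrow> 0) at_bot"
  proof (rule energy_at_bot[OF W'])
    fix \<epsilon> :: real assume "\<epsilon> > 0"
    then obtain z0 where "z0 < 0" "\<And>z. z \<le> z0 \<Longrightarrow> \<bar>indef F z + c\<bar> \<le> \<epsilon> * \<bar>z\<bar>"
      using indef_sublinear[OF F, of "\<integral>z. (fun_of f z)\<^sup>2 \<partial>neg_leb" \<epsilon> c]
        sq_int_ext0_integral[OF fun_of_sq_int] unfolding F_def by blast
    then show "\<exists>z0<0. \<forall>z\<le>z0. \<bar>G z\<bar> \<le> \<epsilon> * \<bar>z\<bar>" by (auto simp: G_def)
  next
    fix a b :: real assume "a < b" "b < 0"
    then show "integral {a..b} (\<lambda>z. (W z)\<^sup>2) \<le> (\<integral>z. (fun_of u z)\<^sup>2 \<partial>neg_leb)"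
      using eqW[of b a "\<lambda>_ x. x\<^sup>2"] sq_int_ext0_integral(2)[OF fun_of_sq_int, of a b u]
      by (simp add: U_def)
  qed
  define k where "k z = F z * U z + (U z)\<^sup>2 / 2" for z
  have UF: "integrable neg_leb (\<lambda>z. fun_of u z * fun_of f z)"
    by (intro sq_int_mult fun_of_sq_int)
  have UU: "integrable neg_leb (\<lambda>z. (fun_of u z)\<^sup>2)"
    using fun_of_sq_int[of u] by (simp add: sq_int_def)
  have "integrable neg_leb (\<lambda>z. fun_of u z * fun_of f z + (fun_of u z)\<^sup>2 / 2)"
    using UF UU by simp
  moreover have "integrable neg_leb k \<longleftrightarrow> integrable neg_leb (\<lambda>z. fun_of u z * fun_of f z + (fun_of u z)\<^sup>2 / 2)"
    by (rule Bochner_Integration.integrable_cong) (auto simp: k_def U_def F_def ext0_def)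
  ultimately have k: "integrable neg_leb k" by simp
  have int_k: "(\<integral>z. k z \<partial>neg_leb) = inner u f + (norm u)\<^sup>2 / 2"
  proof -
    have "(\<integral>z. k z \<partial>neg_leb) = (\<integral>z. fun_of u z * fun_of f z + (fun_of u z)\<^sup>2 / 2 \<partial>neg_leb)"
      by (rule Bochner_Integration.integral_cong) (auto simp: k_def U_def F_def ext0_def)
    also have "\<dots> = inner u f + inner u u / 2"
      using UF UU by (simp add: inner_fun_of power2_eq_square)
    finally show ?thesis by (simp add: power2_norm_eq_inner)
  qed
  \<comment> \<open>The offset 2 gives \<open>a n \<le> -2\<close> and
    \<open>b n \<ge> - 1 / 2\<close>, so the intervals are nondegenerate from \<open>n = 0\<close>
    on.\<close>
  define a b where "a n = - (2 + real n)" and "b n = - inverse ((2 + real n))" for n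
  have ab: "a n < b n" "b n < 0" for n
  proof -
    have "inverse ((2 + real n)) < 1" by (simp add: inverse_eq_divide)
    then show "a n < b n" "b n < 0" by (auto simp: a_def b_def)
  qed
  have top: "filterlim (\<lambda>n. (2 + real n)) at_top sequentially"
    by (rule filterlim_tendsto_add_at_top[OF tendsto_const filterlim_real_sequentially])
  then have a_lim: "filterlim a at_bot sequentially"
    by (simp only: a_def[abs_def] filterlim_uminus_at_bot minus_minus)
  have "b \<longlonglongrightarrow> - 0"
    unfolding b_def[abs_def] by (intro tendsto_minus tendsto_inverse_0_at_top top)
  then have b_lim: "filterlim b (at_left 0) sequentially"
    using ab(2) by (auto simp: filterlim_at less_imp_neq)
  have "(\<lambda>n. \<integral>z. indicator {a n..b n} z * k z \<partial>neg_leb) \<longlonglongrightarrow> (\<integral>z. k z \<partial>neg_leb)"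
  proof (rule integral_dominated_convergence[where w = "\<lambda>z. \<bar>k z\<bar>"])
    show "k \<in> borel_measurable neg_leb" using k by simp
    show "(\<lambda>z. indicator {a n..b n} z * k z) \<in> borel_measurable neg_leb" for n
      using k ab(2)[of n] by (intro borel_measurable_times borel_measurable_indicator) (auto simp: sets_restrict_space_iff)
    show "integrable neg_leb (\<lambda>z. \<bar>k z\<bar>)" using k by simp
    show "AE z in neg_leb. norm (indicator {a n..b n} z * k z) \<le> \<bar>k z\<bar>" for n
      by (auto simp: indicator_def)
    show "AE z in neg_leb. (\<lambda>n. indicator {a n..b n} z * k z) \<longlonglongrightarrow> k z"
    proof (rule AE_I2)
      fix z assume "z \<in> space neg_leb"
      then have z: "z < 0" by simp
      have "\<forall>\<^sub>F n in sequentially. a n \<le> z"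
        using a_lim by (simp add: filterlim_at_bot)
      moreover have "\<forall>\<^sub>F n in sequentially. z < b n"
        using b_lim z by (auto simp: filterlim_at order_tendsto_iff)
      ultimately have "\<forall>\<^sub>F n in sequentially. k z = indicator {a n..b n} z * k z"
        by eventually_elim simp
      then show "(\<lambda>n. indicator {a n..b n} z * k z) \<longlonglongrightarrow> k z"
        by (rule Lim_transform_eventually[OF tendsto_const])
    qed
  qed
  moreover have "(\<integral>z. indicator {a n..b n} z * k z \<partial>neg_leb) \<le> energy G W (b n) - energy G W (a n)" for n
  proof -
    have sub: "{a n..b n} \<subseteq> {..<0}" using ab[of n] by auto
    have "k absolutely_integrable_on {..<0}"
      using k by (simp add: set_integrable_def integrable_restrict_space)
    then have "k absolutely_integrable_on {a n..b n}"
      by (rule set_integrable_subset) (use sub in auto)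
    moreover have "k absolutely_integrable_on {a n..b n} \<longleftrightarrow>
        (\<lambda>z. indicator {a n..b n} z * k z) absolutely_integrable_on {a n..b n}"
      by (rule set_integrable_cong) auto
    ultimately have "(\<integral>z. indicator {a n..b n} z * k z \<partial>neg_leb)
        = integral {a n..b n} (\<lambda>z. indicator {a n..b n} z * k z)"
      using ab[of n] by (intro neg_integral_support) auto
    also have "\<dots> = integral {a n..b n} k"
      by (rule Henstock_Kurzweil_Integration.integral_cong) simp
    also have "\<dots> = integral {a n..b n} (\<lambda>z. F z * W z + (W z)\<^sup>2 / 2)"
      using eqW[OF ab(2)[of n], of "a n" "\<lambda>z x. F z * x + x\<^sup>2 / 2"] by (simp add: k_def[abs_def])
    also have "\<dots> \<le> energy G W (b n) - energy G W (a n)"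
      by (rule energy_estimate[OF W' F G_def ab])
    finally show ?thesis .
  qed
  moreover have "(\<lambda>n. energy G W (b n) - energy G W (a n)) \<longlonglongrightarrow> - c\<^sup>2 / 4 - 0"
    by (intro tendsto_diff filterlim_compose[OF right b_lim] filterlim_compose[OF left a_lim])
  ultimately have "(\<integral>z. k z \<partial>neg_leb) \<le> - c\<^sup>2 / 4 - 0"
    by (meson LIMSEQ_le)
  also have "\<dots> \<le> 0" by simp
  finally show ?thesis using int_k by simp
qed

theorem corollary6p2:
  fixes w w\<^sub>t :: "real \<Rightarrow> L2neg"
  assumes C_Dom: "continuous_into_Dom_H w"
    and C1_deriv: "\<forall>t\<ge>0. (w has_vector_derivative w\<^sub>t t) (at t within {0..})"
    and C1_cont: "continuous_on {0..} w\<^sub>t"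
    and evolution: "\<forall>t\<ge>0. w\<^sub>t t = H (w t)"
  shows "\<forall>t\<ge>0. (norm (w t))\<^sup>2 \<le> (norm (w 0))\<^sup>2 * exp (- t)"
proof (intro allI impI)
  fix T :: real assume T: "T \<ge> 0"
  have diss: "inner (w t) (w\<^sub>t t) \<le> - (norm (w t))\<^sup>2 / 2" if "t \<ge> 0" for t
  proof (rule is_H_dissipative)
    \<comment> \<open>Membership in \<open>Dom_H\<close> makes the choice in the definition of
      \<open>H\<close> a genuine weak image.\<close>
    have "\<exists>f. is_H (w t) f"
      using C_Dom that by (auto simp: continuous_into_Dom_H_def Dom_H_def)
    then have "is_H (w t) (H (w t))"
      unfolding H_def by (rule someI_ex)
    then show "is_H (w t) (w\<^sub>t t)" using evolution that by simp
  qed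
  define \<phi> where "\<phi> t = exp t * inner (w t) (w t)" for t
  define \<phi>' where "\<phi>' t = exp t * (2 * inner (w t) (w\<^sub>t t) + inner (w t) (w t))" for t
  have d: "(\<phi> has_real_derivative \<phi>' t) (at t within {0..T})" if t: "t \<in> {0..T}" for t
  proof -
    have "(w has_derivative (\<lambda>h. h *\<^sub>R w\<^sub>t t)) (at t within {0..T})"
      using C1_deriv t has_derivative_subset[of w _ t "{0..}" "{0..T}"]
      by (auto simp: has_vector_derivative_def)
    then have "((\<lambda>t. inner (w t) (w t)) has_derivative
        (\<lambda>h. inner (w t) (h *\<^sub>R w\<^sub>t t) + inner (h *\<^sub>R w\<^sub>t t) (w t))) (at t within {0..T})"
      by (intro has_derivative_inner)
    moreover have "(\<lambda>h. inner (w t) (h *\<^sub>R w\<^sub>t t) + inner (h *\<^sub>R w\<^sub>t t) (w t))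
        = (*) (2 * inner (w t) (w\<^sub>t t))"
      by (auto simp: inner_commute)
    ultimately have "((\<lambda>t. inner (w t) (w t)) has_real_derivative 2 * inner (w t) (w\<^sub>t t)) (at t within {0..T})"
      by (simp add: has_field_derivative_def)
    then show ?thesis
      unfolding \<phi>_def \<phi>'_def
      by (auto intro!: derivative_eq_intros simp: algebra_simps)
  qed
  \<comment> \<open>Dissipativity says exactly that twice the inner product is at most
    \<open>- (norm (w t))\<^sup>2\<close>, which cancels the term produced by differentiating
    \<open>exp t\<close>.\<close>
  have \<phi>'_nonpos: "\<phi>' t \<le> 0" if "t \<in> {0..T}" for t
    using diss[of t] that by (simp add: \<phi>'_def mult_le_0_iff power2_norm_eq_inner)
  have "\<phi> T \<le> \<phi> 0"
  proof (intro DERIV_nonpos_imp_decreasing_open[OF T])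
    fix t assume t: "0 < t" "t < T"
    then have "(\<phi> has_real_derivative \<phi>' t) (at t)"
      using d[of t] by (simp add: at_within_Icc_at)
    then show "\<exists>y. (\<phi> has_real_derivative y) (at t) \<and> y \<le> 0"
      using  \<phi>'_nonpos t by auto
  next
    show "continuous_on {0..T} \<phi>"
      using d by (meson DERIV_continuous continuous_on_eq_continuous_within)
  qed
  then show "(norm (w T))\<^sup>2 \<le> (norm (w 0))\<^sup>2 * exp (- T)"
    by (simp add: \<phi>_def power2_norm_eq_inner exp_minus field_simps)
qed

end
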